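(* Let $m,J\in\mathbb Z_{\ge1}$ and $s,r,\gamma\in\mathbb R$ with $r>0$ and $\gamma>J+1$. For the dynamical $(J;\gamma)$-PEP set $$\mathfrak H_T(s,r;\gamma)=T^{-1/4}\,\mathfrak h_{\lfloor rT\rfloor}\Big(\Big\lfloor\frac{JrT}{J+1}+sT^{1/4}\Big\rfloor\Big).$$ Then $$\lim_{T\to\infty}\mathbb E\Big[\mathfrak H_T(s,r;\gamma)^m\big(\mathfrak H_T(s,r;\gamma)+s(J+1)\big)^m\Big]=\Big(\frac{rJ}{2\pi}\Big)^{m/2}(\gamma)_m=\mathbb E[\chi_{a,b}^m],$$ where $a=\gamma$, $b=\sqrt{2\pi/(rJ)}$, $(\gamma)_m=\prod_{j=0}^{m-1}(\gamma+j)$, and $\chi_{a,b}$ is a Gamma random variable with density $\Gamma(a)^{-1}b^ax^{a-1}e^{-bx}$ on $x>0$.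
   Context: Dynamical $(J;\gamma)$-PEP: fix $J\in\mathbb Z_{>0}$ and real $\gamma>J+1$. It is a discrete-time Markov process $\eta(t)=(\eta_1(t),\eta_2(t),\dots)$, $t\in\mathbb Z_{\ge0}$, with $\eta_k(t)\in\{0,1,\dots,J+1\}$, started from $\eta_k(0)=0$ for all $k$. Define $\mathfrak h_t(x)=\sum_{j\ge x}\eta_j(t)$, $\mathfrak a_t(x)=\sum_{j=1}^{x-1}(J+1-\eta_j(t))$, and $\Upsilon(k;t)=\gamma+\mathfrak h_t(k)+\mathfrak a_t(k)$. Given $\eta(t)$, set $X_0(t)=J$ and let $X_1(t),X_2(t),\dots$ be conditionally independent with $X_k(t)\in\{\eta_k(t)-1,\eta_k(t)\}$, $$\mathbb P[X_k(t)=\eta_k(t)-1]=\frac{\eta_k(t)}{J+1}\Big(1+\frac{J+1-\eta_k(t)}{\Upsilon(k;t)}\Big),\quad \mathbb P[X_k(t)=\eta_k(t)]=\frac{J+1-\eta_k(t)}{J+1}\Big(1-\frac{\eta_k(t)}{\Upsilon(k;t)}\Big);$$ then $\eta_k(t+1)=\eta_k(t)-X_k(t)+X_{k-1}(t)$ for $k\ge1$. *)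

theory Defs
  imports "HOL-Probability.Probability" "HOL-Analysis.Analysis"
begin

text \<open>Configurations eta :: nat => nat, with eta k the occupation of site k (k >= 1);
  the value at index 0 is unused and kept equal to 0.\<close>

text \<open>Height function: sum over j >= x (j >= 1) of eta j.  All reachable configurations
  are finitely supported, so the sum over the nonzero sites is the full sum.\<close>
definition PEP_h :: "(nat \<Rightarrow> nat) \<Rightarrow> int \<Rightarrow> nat" where
  "PEP_h \<eta> x = (\<Sum>j | 1 \<le> j \<and> x \<le> int j \<and> \<eta> j \<noteq> 0. \<eta> j)"

definition PEP_a :: "nat \<Rightarrow> (nat \<Rightarrow> nat) \<Rightarrow> nat \<Rightarrow> real" where
  "PEP_a J \<eta> x = (\<Sum>j\<in>{1..<x}. real (J + 1) - real (\<eta> j))"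

definition PEP_Upsilon :: "nat \<Rightarrow> real \<Rightarrow> (nat \<Rightarrow> nat) \<Rightarrow> nat \<Rightarrow> real" where
  "PEP_Upsilon J \<gamma> \<eta> k = \<gamma> + real (PEP_h \<eta> (int k)) + PEP_a J \<eta> k"

text \<open>Probability that X_k = eta_k - 1.\<close>
definition PEP_p :: "nat \<Rightarrow> real \<Rightarrow> (nat \<Rightarrow> nat) \<Rightarrow> nat \<Rightarrow> real" where
  "PEP_p J \<gamma> \<eta> k = real (\<eta> k) / real (J + 1) *
      (1 + (real (J + 1) - real (\<eta> k)) / PEP_Upsilon J \<gamma> \<eta> k)"

fun bern_vec :: "(nat \<Rightarrow> real) \<Rightarrow> nat \<Rightarrow> (nat \<Rightarrow> bool) pmf" where
  "bern_vec p 0 = return_pmf (\<lambda>_. False)"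
| "bern_vec p (Suc n) =
     bind_pmf (bern_vec p n) (\<lambda>B. map_pmf (\<lambda>c. B(Suc n := c)) (bernoulli_pmf (p (Suc n))))"

definition PEP_update :: "nat \<Rightarrow> (nat \<Rightarrow> nat) \<Rightarrow> (nat \<Rightarrow> bool) \<Rightarrow> nat \<Rightarrow> nat" where
  "PEP_update J \<eta> B =
     (let X = (\<lambda>k. if k = 0 then int J else int (\<eta> k) - (if B k then 1 else 0))
      in (\<lambda>k. if k = 0 then 0 else nat (int (\<eta> k) - X k + X (k - 1))))"

text \<open>One step of the chain, randomizing sites 1..n (sites with eta_k = 0 have
  P[X_k = eta_k - 1] = 0, so sites beyond the support are deterministic).\<close>
definition PEP_step :: "nat \<Rightarrow> real \<Rightarrow> nat \<Rightarrow> (nat \<Rightarrow> nat) \<Rightarrow> (nat \<Rightarrow> nat) pmf" where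
  "PEP_step J \<gamma> n \<eta> = map_pmf (PEP_update J \<eta>) (bern_vec (PEP_p J \<gamma> \<eta>) n)"

text \<open>Law of eta(t), started from the empty configuration.  At time t the support of eta(t)
  lies in {1..t}, so randomizing sites 1..t+1 in the step from t to t+1 is exact.\<close>
fun PEP_dist :: "nat \<Rightarrow> real \<Rightarrow> nat \<Rightarrow> (nat \<Rightarrow> nat) pmf" where
  "PEP_dist J \<gamma> 0 = return_pmf (\<lambda>_. 0)"
| "PEP_dist J \<gamma> (Suc t) = bind_pmf (PEP_dist J \<gamma> t) (PEP_step J \<gamma> (Suc t))"

text \<open>Rescaled height H_T(s,r) as a function of the configuration at time floor(r T).\<close>
definition PEP_H :: "nat \<Rightarrow> real \<Rightarrow> real \<Rightarrow> real \<Rightarrow> (nat \<Rightarrow> nat) \<Rightarrow> real" where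
  "PEP_H J T s r \<eta> = T powr (-1/4) *
     real (PEP_h \<eta> \<lfloor>real J * r * T / real (J + 1) + s * T powr (1/4)\<rfloor>)"

end

theory Submission
  imports Defs "HOL-Real_Asymp.Real_Asymp"
begin

text \<open>
  Let \<open>K = J + 1\<close>. In the moving frame the height obeys \<open>h\<^sub>t\<^sub>+\<^sub>1 (x + 1) = h\<^sub>t x - B x\<close>, where \<open>B x\<close> says that one
  particle stays at \<open>x\<close>. The products \<open>\<Prod>i<m. (h (x i) - i) (a (x i) + \<gamma> + i)\<close> over weakly decreasing points
  \<open>x 0 \<ge> x 1 \<ge> \<dots>\<close> evolve in mean by a closed linear recursion, and it is the same recursion that
  \<open>\<Prod>i<m. h (x i) - i\<close> satisfies for the static process (\<open>\<gamma> = \<infinity>\<close>). The two initial values differ by the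
  factor \<open>(\<gamma>)\<^sub>m\<close>, so the dynamic moments are \<open>(\<gamma>)\<^sub>m\<close> times static factorial moments.

  In the static process \<open>h\<close> concentrates: Bernoulli's inequality gives \<open>E (exp (b h)) \<le> exp ((exp b - 1) E h)\<close>,
  hence the \<open>m\<close>-th factorial moment is asymptotically \<open>(E h)\<^sup>m\<close>. The mean is \<open>K\<close> times the expected positive
  part of a shifted binomial variable, which the central limit theorem evaluates. Finally \<open>a\<close> and
  \<open>h + s K T\<^bsup>1/4\<^esup>\<close> differ by a bounded amount, and passing to ordinary moments costs a relative error
  \<open>O(T\<^bsup>-1/4\<^esup>)\<close>.
\<close>



subsection \<open>Mean absolute deviation of the binomial distribution\<close>

text \<open>Why \<open>\<gamma>\<close> drops out of the recursion: when the stay variable at one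
  site is averaged over a block of \<open>n\<close> points, a common factor splits off, and in what
  remains the stay probability \<open>q\<close> enters only as
  \<open>n * q * (h + a + \<gamma>)\<close>. But \<open>h + a + \<gamma>\<close> is
  \<open>PEP_Upsilon\<close>, the denominator in \<open>PEP_p\<close>, so it cancels and a
  polynomial identity is left. The shifts by \<open>i\<close> make the products over a block differ
  only in their end factors. They also tie each factor to its index, which is why the points stay
  ordered and only the first point of a block moves. The weights of the recursion can be negative,
  so there is no dual Markov process to couple with; the two processes are compared by induction on
  time, using linearity alone. In the limit the static height is of order \<open>sqrt T\<close> and
  only its mean matters, so the spread of the Gamma law comes entirely from
  \<open>pochhammer \<gamma> m\<close>.\<close>

lemma expectation_binomial_step:
  fixes f :: "nat \<Rightarrow> real"
  assumes p: "p \<in> {0..1}"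
  shows "measure_pmf.expectation (binomial_pmf (Suc n) p) f =
    p * measure_pmf.expectation (binomial_pmf n p) (\<lambda>k. f (Suc k))
      + (1 - p) * measure_pmf.expectation (binomial_pmf n p) f"
proof -
  have fin: "finite (set_pmf (binomial_pmf n p))" using p by auto
  have "binomial_pmf (Suc n) p =
      bernoulli_pmf p \<bind> (\<lambda>b. map_pmf (\<lambda>k. (if b then 1 else 0) + k) (binomial_pmf n p))"
    using p by (simp add: binomial_pmf_Suc map_pmf_def)
  then show ?thesis using p fin
    by (simp only:, subst pmf_expectation_bind[where A = UNIV]) (auto simp: UNIV_bool)
qed

lemma binomial_central_moments:
  assumes p: "p \<in> {0..1}"
  shows "measure_pmf.expectation (binomial_pmf n p) (\<lambda>k. real k - real n * p) = 0"
    and "measure_pmf.expectation (binomial_pmf n p) (\<lambda>k. (real k - real n * p)\<^sup>2) = real n * p * (1 - p)"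
proof -
  let ?E = "\<lambda>n. measure_pmf.expectation (binomial_pmf n p)"
  have I: "integrable (binomial_pmf n p) f" for n and f :: "nat \<Rightarrow> real" using p by auto
  have 1: "?E n (\<lambda>k. real k - real n * p) = 0" for n
  proof (induction n)
    case (Suc n)
    have "?E n (\<lambda>k. real (Suc k) - real (Suc n) * p) = ?E n (\<lambda>k. (real k - real n * p) + (1 - p))"
      by (intro Bochner_Integration.integral_cong) (auto simp: algebra_simps)
    also have "\<dots> = 1 - p" using Suc by (simp add: I del: Bochner_Integration.integral_diff)
    finally have a: "?E n (\<lambda>k. real (Suc k) - real (Suc n) * p) = 1 - p" .
    have "?E n (\<lambda>k. real k - real (Suc n) * p) = ?E n (\<lambda>k. (real k - real n * p) - p)"
      by (intro Bochner_Integration.integral_cong) (auto simp: algebra_simps)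
    also have "\<dots> = - p" using Suc by (subst Bochner_Integration.integral_diff) (simp_all add: I)
    finally show ?case unfolding expectation_binomial_step[OF p] a by (simp add: algebra_simps)
  qed (use p in \<open>simp add: binomial_pmf_0\<close>)
  then show "?E n (\<lambda>k. real k - real n * p) = 0" .
  show "?E n (\<lambda>k. (real k - real n * p)\<^sup>2) = real n * p * (1 - p)"
  proof (induction n)
    case (Suc n)
    \<comment> \<open>The cross term has mean zero. The values \<open>c = 1 - p\<close> and
      \<open>c = - p\<close> are the recentrings caused by the two outcomes of the new
      trial.\<close>
    have shift: "?E n (\<lambda>k. (real k - real n * p + c)\<^sup>2) = real n * p * (1 - p) + c\<^sup>2" for c
    proof -
      have "?E n (\<lambda>k. (real k - real n * p + c)\<^sup>2)
          = ?E n (\<lambda>k. (real k - real n * p)\<^sup>2 + (2 * c) * (real k - real n * p) + c\<^sup>2)"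
        by (intro Bochner_Integration.integral_cong) (auto simp: power2_eq_square algebra_simps)
      also have "\<dots> = ?E n (\<lambda>k. (real k - real n * p)\<^sup>2) + (2 * c) * ?E n (\<lambda>k. real k - real n * p) + c\<^sup>2"
        by (subst Bochner_Integration.integral_add, (rule I)+)+
           (simp del: Bochner_Integration.integral_diff)
      finally show ?thesis using 1 Suc by simp
    qed
    have "real (Suc k) - real (Suc n) * p = real k - real n * p + (1 - p)"
      "real k - real (Suc n) * p = real k - real n * p + (- p)" for k
      by (simp_all add: algebra_simps)
    then have "?E (Suc n) (\<lambda>k. (real k - real (Suc n) * p)\<^sup>2)
      = p * ?E n (\<lambda>k. (real k - real n * p + (1 - p))\<^sup>2) + (1 - p) * ?E n (\<lambda>k. (real k - real n * p + (- p))\<^sup>2)"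
      unfolding expectation_binomial_step[OF p] by (simp only:)
    then show ?case unfolding shift by (simp add: algebra_simps power2_eq_square)
  qed (use p in \<open>simp add: binomial_pmf_0\<close>)
qed

section \<open>Central limit theorem for the binomial law by characteristic functions\<close>

lemma char_binomial:
  assumes p: "p \<in> {0..1}"
  shows "char (distr (binomial_pmf n p) borel (\<lambda>k. (real k - real n * p) / c)) t =
     (of_real p * iexp (t * (1 - p) / c) + of_real (1 - p) * iexp (- t * p / c)) ^ n"
proof -
  have "char (distr (binomial_pmf n p) borel (\<lambda>k. (real k - real n * p) / c)) t =
     measure_pmf.expectation (binomial_pmf n p) (\<lambda>k. iexp (t * ((real k - real n * p) / c)))"
    by (simp add: char_def integral_distr)
  also have "\<dots> = (\<Sum>k\<le>n. (real (n choose k) * p ^ k * (1 - p) ^ (n - k)) *\<^sub>R iexp (t * ((real k - real n * p) / c)))"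
    by (rule expectation_binomial_pmf'[OF p])
  also have "\<dots> = (\<Sum>k\<le>n. of_nat (n choose k) * (of_real p * iexp (t * (1 - p) / c)) ^ k
      * (of_real (1 - p) * iexp (- t * p / c)) ^ (n - k))"
  proof (intro sum.cong refl)
    fix k assume k: "k \<in> {..n}"
    have "iexp (t * ((real k - real n * p) / c)) = iexp (t * (1 - p) / c) ^ k * iexp (- t * p / c) ^ (n - k)"
      using k unfolding exp_of_nat_mult[symmetric] exp_add[symmetric]
      by (simp add: of_nat_diff algebra_simps divide_simps)
    then show "(real (n choose k) * p ^ k * (1 - p) ^ (n - k)) *\<^sub>R iexp (t * ((real k - real n * p) / c)) =
      of_nat (n choose k) * (of_real p * iexp (t * (1 - p) / c)) ^ k
      * (of_real (1 - p) * iexp (- t * p / c)) ^ (n - k)"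
      by (simp add: scaleR_conv_of_real power_mult_distrib)
  qed
  also have "\<dots> = (of_real p * iexp (t * (1 - p) / c) + of_real (1 - p) * iexp (- t * p / c)) ^ n"
    by (subst binomial_ring) (simp add: mult_ac)
  finally show ?thesis .
qed

text \<open>The exponents have weighted mean \<open>p * (1 - p) - (1 - p) * p = 0\<close> and
  weighted second moment \<open>p * (1 - p)\<close>, so the quadratic Taylor polynomials combine to
  the real number subtracted here; two cubic remainders are left.\<close>

lemma two_point_char_approx:
  assumes p: "p \<in> {0..1}"
  shows "cmod (of_real p * iexp (u * (1 - p)) + of_real (1 - p) * iexp (- u * p)
            - of_real (1 - u\<^sup>2 * (p * (1 - p)) / 2)) \<le> \<bar>u\<bar> ^ 3"
proof -
  define T :: "real \<Rightarrow> complex" where "T x = 1 + \<i> * of_real x - of_real x ^ 2 / 2" for x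
  have e: "cmod (iexp x - T x) \<le> \<bar>x\<bar>^3" for x
  proof -
    have "T x = (\<Sum>k\<le>2. (\<i> * of_real x)^k / fact k)"
      by (simp add: T_def numeral_2_eq_2 power2_eq_square algebra_simps)
    then have "cmod (iexp x - T x) \<le> \<bar>x\<bar>^3 / 6"
      using iexp_approx1[of x 2] by (simp add: fact_numeral eval_nat_numeral)
    also have "\<dots> \<le> \<bar>x\<bar>^3" by simp
    finally show ?thesis .
  qed
  define a b where "a = iexp (u * (1 - p))" and "b = iexp (- u * p)"
  have eq: "of_real p * a + of_real (1 - p) * b - of_real (1 - u\<^sup>2 * (p * (1 - p)) / 2)
     = of_real p * (a - T (u * (1 - p))) + of_real (1 - p) * (b - T (- u * p))"
    unfolding T_def by (simp add: field_simps power2_eq_square)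
  have "cmod (of_real p * (a - T (u * (1 - p))) + of_real (1 - p) * (b - T (- u * p)))
     \<le> p * cmod (a - T (u * (1 - p))) + (1 - p) * cmod (b - T (- u * p))"
    using p by (intro order_trans[OF norm_triangle_ineq]) (simp add: norm_mult del: of_real_diff)
  also have "\<dots> \<le> p * \<bar>u * (1 - p)\<bar>^3 + (1 - p) * \<bar>- u * p\<bar>^3"
    using p unfolding a_def b_def by (intro add_mono mult_left_mono e) auto
  also have "\<dots> \<le> p * \<bar>u\<bar>^3 + (1 - p) * \<bar>u\<bar>^3"
    using p by (intro add_mono mult_left_mono power_mono) (auto simp: abs_mult mult_left_le)
  also have "\<dots> = \<bar>u\<bar>^3" by (simp add: algebra_simps)
  finally show ?thesis unfolding a_def[symmetric] b_def[symmetric] eq .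
qed

lemma binomial_weak_conv:
  assumes p: "0 < p" "p < 1"
  shows "weak_conv_m (\<lambda>n. distr (binomial_pmf n p) borel
           (\<lambda>k. (real k - real n * p) / sqrt (real n * p * (1 - p)))) std_normal_distribution"
proof (rule levy_continuity)
  fix n show "real_distribution (distr (measure_pmf (binomial_pmf n p)) borel
           (\<lambda>k. (real k - real n * p) / sqrt (real n * p * (1 - p))))"
    by (intro prob_space.real_distribution_distr measure_pmf.prob_space_axioms) simp
next
  fix t :: real
  define v where "v = p * (1 - p)"
  have v: "v > 0" using p by (simp add: v_def)
  define \<phi> where "\<phi> n = of_real p * iexp (t * (1 - p) / sqrt (real n * v)) + of_real (1 - p) * iexp (- t * p / sqrt (real n * v))" for n
  have char: "char (distr (binomial_pmf n p) borel
           (\<lambda>k. (real k - real n * p) / sqrt (real n * p * (1 - p)))) t = \<phi> n ^ n" for n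
    using p by (subst char_binomial) (auto simp: \<phi>_def v_def mult.assoc)
  have \<phi>1: "cmod (\<phi> n) \<le> 1" for n
    unfolding \<phi>_def using p
    by (intro order_trans[OF norm_triangle_ineq]) (simp add: norm_mult del: of_real_diff of_real_divide of_real_mult)
  have "\<forall>\<^sub>F n in sequentially. cmod (\<phi> n ^ n - of_real ((1 + (-(t^2) / 2) / n)^n)) \<le> \<bar>t\<bar> ^ 3 / (v * sqrt v) * (1 / sqrt (real n))"
  proof (rule eventually_sequentiallyI)
    \<comment> \<open>From \<open>n \<ge> t^2 / 4\<close> the number
      \<open>1 - t^2 / (2 * n)\<close> lies in [-1, 1], as the comparison of powers by
      \<open>norm_power_diff\<close> requires; \<open>Suc\<close> makes \<open>n\<close>
      positive.\<close>
    fix n :: nat assume "n \<ge> Suc (nat (ceiling (t^2 / 4)))"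
    then have n: "real n \<ge> t^2 / 4" "n > 0" by linarith+
    let ?z = "of_real (1 + (-(t^2) / 2) / n) :: complex"
    define u where "u = t / sqrt (real n * v)"
    have uv: "u\<^sup>2 * v = t\<^sup>2 / n" using n v by (simp add: u_def power_divide)
    have z: "cmod ?z \<le> 1" using n by (auto intro!: abs_leI simp del: of_real_diff simp: of_real_diff[symmetric] divide_le_eq)
    have "cmod (\<phi> n - ?z) \<le> \<bar>u\<bar> ^ 3"
    proof -
      have "t * (1 - p) / sqrt (real n * v) = u * (1 - p)" "- t * p / sqrt (real n * v) = - u * p"
        "1 + (-(t^2) / 2) / n = 1 - u\<^sup>2 * (p * (1 - p)) / 2"
        using uv by (simp_all add: u_def v_def)
      then show ?thesis using two_point_char_approx[of p u] p unfolding \<phi>_def by (simp only:) auto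
    qed
    then have "cmod (\<phi> n ^ n - ?z ^ n) \<le> n * \<bar>u\<bar>^3"
      by (intro order_trans[OF norm_power_diff[OF \<phi>1 z]] mult_left_mono) auto
    also have "n * \<bar>u\<bar>^3 = \<bar>t\<bar> ^ 3 / (v * sqrt v) * (1 / sqrt (real n))"
      using n v by (simp add: u_def abs_divide power_divide real_sqrt_mult power3_eq_cube power_mult_distrib field_simps)
    finally show "cmod (\<phi> n ^ n - of_real ((1 + (-(t^2) / 2) / n)^n)) \<le> \<bar>t\<bar> ^ 3 / (v * sqrt v) * (1 / sqrt (real n))"
      by simp
  qed
  moreover have "(\<lambda>n. \<bar>t\<bar> ^ 3 / (v * sqrt v) * (1 / sqrt (real n))) \<longlonglongrightarrow> 0" by real_asymp
  ultimately have "(\<lambda>n. \<phi> n ^ n - of_real ((1 + (-(t^2) / 2) / n)^n)) \<longlonglongrightarrow> 0"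
    by (rule Lim_null_comparison)
  moreover have "(\<lambda>n. complex_of_real ((1 + (-(t^2) / 2) / n)^n)) \<longlonglongrightarrow> complex_of_real (exp (-(t^2) / 2))"
    by (rule isCont_tendsto_compose [OF _ tendsto_exp_limit_sequentially]) auto
  ultimately have "(\<lambda>n. \<phi> n ^ n) \<longlonglongrightarrow> complex_of_real (exp (-(t^2) / 2))"
    by (rule Lim_transform[rotated])
  then show "(\<lambda>n. char (distr (measure_pmf (binomial_pmf n p)) borel
           (\<lambda>k. (real k - real n * p) / sqrt (real n * p * (1 - p)))) t) \<longlonglongrightarrow> char std_normal_distribution t"
    unfolding char by (simp add: char_std_normal_distribution)
qed (rule real_dist_normal_dist)

text \<open>Weak convergence controls only bounded continuous functions. Cutting
  \<open>\<bar>x\<bar>\<close> off at \<open>c\<close> costs at most \<open>x^2 / c\<close>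
  pointwise, so the common bound on second moments makes this cost uniformly small.\<close>

lemma weak_conv_abs_moment:
  assumes d: "\<And>n. real_distribution (M n)" "real_distribution N" and w: "weak_conv_m M N"
    and i: "\<And>n. integrable (M n) (\<lambda>x. x\<^sup>2)" "integrable N (\<lambda>x. x\<^sup>2)"
    and b: "\<And>n. (LINT x|M n. x\<^sup>2) \<le> 1" "(LINT x|N. x\<^sup>2) \<le> 1"
  shows "(\<lambda>n. LINT x|M n. \<bar>x\<bar>) \<longlonglongrightarrow> (LINT x|N. \<bar>x\<bar>)"
proof -
  have trunc: "\<bar>(LINT x|P. \<bar>x\<bar>) - (LINT x|P. min \<bar>x\<bar> c)\<bar> \<le> 1 / c"
    if P: "real_distribution P" "integrable P (\<lambda>x. x\<^sup>2)" "(LINT x|P. x\<^sup>2) \<le> 1" and c: "c > 0" for P and c :: real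
  proof -
    interpret real_distribution P by fact
    have "integrable P (\<lambda>x. x)" by (rule square_integrable_imp_integrable) (use P in auto)
    then have ia: "integrable P (\<lambda>x. \<bar>x\<bar>)" by simp
    have im: "integrable P (\<lambda>x. min \<bar>x\<bar> c)"
      by (rule Bochner_Integration.integrable_bound[OF ia]) (use c in auto)
    have "(LINT x|P. \<bar>x\<bar>) - (LINT x|P. min \<bar>x\<bar> c) = (LINT x|P. \<bar>x\<bar> - min \<bar>x\<bar> c)"
      using ia im by simp
    also have "\<dots> \<le> (LINT x|P. x\<^sup>2 / c)"
    proof (rule integral_mono)
      show "integrable P (\<lambda>x. \<bar>x\<bar> - min \<bar>x\<bar> c)" "integrable P (\<lambda>x. x\<^sup>2 / c)" using ia im P by auto
      fix x :: real
      have "c * \<bar>x\<bar> \<le> \<bar>x\<bar> * \<bar>x\<bar>" if "\<bar>x\<bar> > c" using that by (intro mult_right_mono) auto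
      then show "\<bar>x\<bar> - min \<bar>x\<bar> c \<le> x\<^sup>2 / c" using c 
        by (cases "\<bar>x\<bar> > c") (auto simp: field_simps power2_eq_square abs_mult_self_eq min_def intro: order_trans)
    qed
    also have "\<dots> \<le> 1 / c" using P c by (simp add: divide_right_mono)
    finally have "(LINT x|P. \<bar>x\<bar>) - (LINT x|P. min \<bar>x\<bar> c) \<le> 1 / c" .
    moreover have "(LINT x|P. min \<bar>x\<bar> c) \<le> (LINT x|P. \<bar>x\<bar>)" by (rule integral_mono[OF im ia]) auto
    ultimately show ?thesis by simp
  qed
  show ?thesis
  proof (rule LIMSEQ_I)
    fix e :: real assume e: "e > 0"
    \<comment> \<open>The two cut-offs and the bounded middle term then cost at most e / 4
      each.\<close>
    define c where "c = 4 / e"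
    have c: "c > 0" "1 / c = e / 4" using e by (auto simp: c_def)
    have "(\<lambda>n. LINT x|M n. min \<bar>x\<bar> c) \<longlonglongrightarrow> (LINT x|N. min \<bar>x\<bar> c)"
      by (rule weak_conv_imp_integral_bdd_continuous_conv[where B = c])
         (use d w c in \<open>auto intro!: continuous_intros\<close>)
    then obtain n0 where n0: "\<And>n. n \<ge> n0 \<Longrightarrow> norm ((LINT x|M n. min \<bar>x\<bar> c) - (LINT x|N. min \<bar>x\<bar> c)) < e / 4"
      using LIMSEQ_D[of _ _ "e/4"] e by (metis divide_pos_pos zero_less_numeral)
    show "\<exists>no. \<forall>n\<ge>no. norm ((LINT x|M n. \<bar>x\<bar>) - (LINT x|N. \<bar>x\<bar>)) < e"
    proof (intro exI allI impI)
      fix n assume "n \<ge> n0"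
      from n0[OF this] trunc[OF d(1) i(1) b(1) c(1), of n] trunc[OF d(2) i(2) b(2) c(1)] c(2)
      show "norm ((LINT x|M n. \<bar>x\<bar>) - (LINT x|N. \<bar>x\<bar>)) < e" unfolding real_norm_def by argo
    qed
  qed
qed

lemma binomial_abs_deviation:
  assumes p: "0 < p" "p < 1"
  shows "(\<lambda>n. measure_pmf.expectation (binomial_pmf n p) (\<lambda>k. \<bar>real k - real n * p\<bar>) / sqrt (real n))
    \<longlonglongrightarrow> sqrt (2 * p * (1 - p) / pi)"
proof -
  define M where "M n = distr (measure_pmf (binomial_pmf n p)) borel (\<lambda>k. (real k - real n * p) / sqrt (real n * p * (1 - p)))" for n
  have p': "p \<in> {0..1}" using p by auto
  have I: "integrable (binomial_pmf n p) f" for n and f :: "nat \<Rightarrow> real" using p by auto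
  have "(\<lambda>n. LINT x|M n. \<bar>x\<bar>) \<longlonglongrightarrow> (LINT x|std_normal_distribution. \<bar>x\<bar>)"
  proof (rule weak_conv_abs_moment)
    show "real_distribution (M n)" for n unfolding M_def
      by (intro prob_space.real_distribution_distr measure_pmf.prob_space_axioms) simp
    show "weak_conv_m M std_normal_distribution" unfolding M_def by (rule binomial_weak_conv[OF p])
    show "integrable (M n) (\<lambda>x. x\<^sup>2)" for n unfolding M_def by (subst integrable_distr_eq) (auto intro: I)
    \<comment> \<open>At \<open>n = 0\<close> the division by \<open>sqrt 0\<close> yields 0, so the
      second moment is 0 there; otherwise it is 1.\<close>
    show "(LINT x|M n. x\<^sup>2) \<le> 1" for n
      unfolding M_def using p binomial_central_moments(2)[OF p', of n]
      by (subst integral_distr) (auto simp: power_divide)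
    show "integrable std_normal_distribution (\<lambda>x. x\<^sup>2)" by (rule integrable_std_normal_distribution_moment)
    show "(LINT x|std_normal_distribution. x\<^sup>2) \<le> 1" using std_normal_distribution_even_moments(1)[of 1] by simp
  qed (rule real_dist_normal_dist)
  then have "(\<lambda>n. sqrt (p * (1 - p)) * (LINT x|M n. \<bar>x\<bar>)) \<longlonglongrightarrow> sqrt (p * (1 - p)) * sqrt (2 / pi)"
    using std_normal_distribution_odd_moments_abs[of 0] by (intro tendsto_mult) auto
  moreover have "sqrt (p * (1 - p)) * (LINT x|M n. \<bar>x\<bar>) =
     measure_pmf.expectation (binomial_pmf n p) (\<lambda>k. \<bar>real k - real n * p\<bar>) / sqrt (real n)" for n
  proof -
    define v where "v = sqrt (p * (1 - p))"
    have v: "v > 0" using p by (simp add: v_def)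
    have "(LINT x|M n. \<bar>x\<bar>) = measure_pmf.expectation (binomial_pmf n p)
       (\<lambda>k. \<bar>real k - real n * p\<bar> / (sqrt (real n) * sqrt (p * (1 - p))))"
      unfolding M_def using p
      by (subst integral_distr) (auto simp: abs_divide real_sqrt_mult[symmetric] mult.assoc)
    also have "\<dots> = measure_pmf.expectation (binomial_pmf n p) (\<lambda>k. \<bar>real k - real n * p\<bar>) / (sqrt (real n) * sqrt (p * (1 - p)))"
      by (rule integral_divide_zero)
    finally show ?thesis using v unfolding v_def[symmetric] by simp
  qed
  ultimately show ?thesis by (simp add: real_sqrt_mult[symmetric] mult_ac)
qed


subsection \<open>Exclusion processes with general rates\<close>

text \<open>The rates are a parameter so that one chain covers both the dynamic process
  (\<open>PEP_p\<close>) and the static one (\<open>static_rate\<close>).\<close>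

fun pep_chain :: "nat \<Rightarrow> ((nat \<Rightarrow> nat) \<Rightarrow> nat \<Rightarrow> real) \<Rightarrow> nat \<Rightarrow> (nat \<Rightarrow> nat) pmf" where
  "pep_chain J R 0 = return_pmf (\<lambda>_. 0)"
| "pep_chain J R (Suc t) =
     bind_pmf (pep_chain J R t) (\<lambda>\<eta>. map_pmf (PEP_update J \<eta>) (bern_vec (R \<eta>) (Suc t)))"

lemma PEP_dist_eq_chain: "PEP_dist J \<gamma> t = pep_chain J (PEP_p J \<gamma>) t"
  by (induction t) (simp_all add: PEP_step_def[abs_def])

text \<open>The reservoir that emits \<open>J\<close> particles per step is modelled by completely filled sites \<open>y \<le> 0\<close>, at
  each of which exactly one particle stays.\<close>

definition site :: "nat \<Rightarrow> (nat \<Rightarrow> nat) \<Rightarrow> int \<Rightarrow> nat" where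
  "site J \<eta> y = (if y \<le> 0 then J + 1 else \<eta> (nat y))"

definition stay :: "(nat \<Rightarrow> bool) \<Rightarrow> int \<Rightarrow> bool" where
  "stay B y \<longleftrightarrow> y \<le> 0 \<or> B (nat y)"

definition height :: "nat \<Rightarrow> nat \<Rightarrow> (nat \<Rightarrow> nat) \<Rightarrow> int \<Rightarrow> real" where
  "height J t \<eta> x = (\<Sum>y\<in>{x..int t}. real (site J \<eta> y))"

text \<open>By conservation the sites from 1 on hold \<open>J * t\<close> particles, so the holes to
  the left of \<open>x\<close> can be read off from \<open>height\<close>. In this form the count
  makes sense for every integer \<open>x\<close>, is 0 for \<open>x \<le> 1\<close> on a
  \<open>pep_state\<close>, and inherits its evolution from \<open>height\<close>.\<close>

definition holes :: "nat \<Rightarrow> nat \<Rightarrow> (nat \<Rightarrow> nat) \<Rightarrow> int \<Rightarrow> real" where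
  "holes J t \<eta> x = height J t \<eta> x + real (J + 1) * (of_int x - 1) - real J * real t"

definition pep_state :: "nat \<Rightarrow> nat \<Rightarrow> (nat \<Rightarrow> nat) \<Rightarrow> bool" where
  "pep_state J t \<eta> \<longleftrightarrow> (\<forall>k. \<eta> k \<le> J + 1) \<and> (\<forall>k>t. \<eta> k = 0) \<and> height J t \<eta> 1 = real J * real t"

text \<open>These are the outcomes for which every site emits between 0 and \<open>J\<close>
  particles.\<close>

definition admissible :: "nat \<Rightarrow> (nat \<Rightarrow> nat) \<Rightarrow> (nat \<Rightarrow> bool) \<Rightarrow> bool" where
  "admissible J \<eta> B \<longleftrightarrow> (\<forall>k\<ge>1. (B k \<longrightarrow> \<eta> k \<noteq> 0) \<and> (\<not> B k \<longrightarrow> \<eta> k \<noteq> J + 1))"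

definition stay_prob :: "(nat \<Rightarrow> real) \<Rightarrow> int \<Rightarrow> real" where
  "stay_prob p y = (if y \<le> 0 then 1 else p (nat y))"

text \<open>The forced values 0 at empty and 1 at full sites make every outcome in the support
  \<open>admissible\<close>.\<close>

definition rate_ok :: "nat \<Rightarrow> (nat \<Rightarrow> nat) \<Rightarrow> (nat \<Rightarrow> real) \<Rightarrow> bool" where
  "rate_ok J \<eta> p \<longleftrightarrow> (\<forall>k\<ge>1. 0 \<le> p k \<and> p k \<le> 1 \<and> (\<eta> k = 0 \<longrightarrow> p k = 0) \<and> (\<eta> k = J + 1 \<longrightarrow> p k = 1))"

section \<open>Independent stay variables\<close>

lemma finite_bern_vec: "finite (set_pmf (bern_vec p n))"
  by (induction n) (auto intro!: finite_imageI)

lemma bern_vec_support: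
  assumes "B \<in> set_pmf (bern_vec p n)" "\<And>k. k \<in> {1..n} \<Longrightarrow> p k \<in> {0..1}"
  shows "B k \<Longrightarrow> k \<in> {1..n} \<and> p k \<noteq> 0"
    and "k \<in> {1..n} \<Longrightarrow> \<not> B k \<Longrightarrow> p k \<noteq> 1"
proof -
  have "\<forall>k. (B k \<longrightarrow> k \<in> {1..n} \<and> p k \<noteq> 0) \<and> (k \<in> {1..n} \<longrightarrow> \<not> B k \<longrightarrow> p k \<noteq> 1)"
    using assms
  proof (induction n arbitrary: B)
    case (Suc n)
    then obtain B' c where B: "B' \<in> set_pmf (bern_vec p n)" "c \<in> set_pmf (bernoulli_pmf (p (Suc n)))" "B = B'(Suc n := c)"
      by auto
    have p: "p (Suc n) \<in> {0..1}" using Suc.prems(2) by simp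
    have c: "c \<Longrightarrow> p (Suc n) \<noteq> 0" "\<not> c \<Longrightarrow> p (Suc n) \<noteq> 1"
      using B(2) p by (auto simp: set_pmf_iff)
    have IH: "\<forall>k. (B' k \<longrightarrow> k \<in> {1..n} \<and> p k \<noteq> 0) \<and> (k \<in> {1..n} \<longrightarrow> \<not> B' k \<longrightarrow> p k \<noteq> 1)"
      using Suc.IH[OF B(1)] Suc.prems(2) by simp
    show ?case
    proof (intro allI)
      fix k
      show "(B k \<longrightarrow> k \<in> {1..Suc n} \<and> p k \<noteq> 0) \<and> (k \<in> {1..Suc n} \<longrightarrow> \<not> B k \<longrightarrow> p k \<noteq> 1)"
        using IH[rule_format, of k] c unfolding B(3) by (cases "k = Suc n") (auto simp: le_Suc_eq)
    qed
  qed auto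
  then show "B k \<Longrightarrow> k \<in> {1..n} \<and> p k \<noteq> 0" "k \<in> {1..n} \<Longrightarrow> \<not> B k \<Longrightarrow> p k \<noteq> 1" by auto
qed

lemma expectation_bern_vec_Suc:
  fixes g :: "(nat \<Rightarrow> bool) \<Rightarrow> real"
  assumes "p (Suc n) \<in> {0..1}"
  shows "measure_pmf.expectation (bern_vec p (Suc n)) g =
    measure_pmf.expectation (bern_vec p n)
      (\<lambda>B. p (Suc n) * g (B(Suc n := True)) + (1 - p (Suc n)) * g (B(Suc n := False)))"
proof -
  have "measure_pmf.expectation (bern_vec p (Suc n)) g =
    (\<Sum>B\<in>set_pmf (bern_vec p n). pmf (bern_vec p n) B *\<^sub>R
      measure_pmf.expectation (map_pmf (\<lambda>c. B(Suc n := c)) (bernoulli_pmf (p (Suc n)))) g)"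
    using finite_bern_vec
    by (simp only: bern_vec.simps, subst pmf_expectation_bind[where A = "set_pmf (bern_vec p n)"]) auto
  also have "\<dots> = (\<Sum>B\<in>set_pmf (bern_vec p n). pmf (bern_vec p n) B *\<^sub>R
      (p (Suc n) * g (B(Suc n := True)) + (1 - p (Suc n)) * g (B(Suc n := False))))"
    using assms by (intro sum.cong refl) (simp del: fun_upd_apply)
  also have "\<dots> = measure_pmf.expectation (bern_vec p n)
      (\<lambda>B. p (Suc n) * g (B(Suc n := True)) + (1 - p (Suc n)) * g (B(Suc n := False)))"
    by (subst integral_measure_pmf[where A = "set_pmf (bern_vec p n)"]) (auto simp: finite_bern_vec)
  finally show ?thesis .
qed

lemma expectation_bern_vec_prod:
  fixes f :: "int \<Rightarrow> bool \<Rightarrow> real"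
  assumes "\<And>k. k \<in> {1..n} \<Longrightarrow> p k \<in> {0..1}" "\<And>k. k > n \<Longrightarrow> p k = 0" "finite X"
  shows "measure_pmf.expectation (bern_vec p n) (\<lambda>B. \<Prod>y\<in>X. f y (stay B y)) =
    (\<Prod>y\<in>X. stay_prob p y * f y True + (1 - stay_prob p y) * f y False)"
proof -
  \<comment> \<open>Inside the induction \<open>p\<close> may be nonzero beyond \<open>n\<close>,
    although \<open>bern_vec p n\<close> lets nothing stay there; hence the case distinction at
    \<open>n\<close> in the intermediate formula.\<close>
  have "measure_pmf.expectation (bern_vec p n) (\<lambda>B. \<Prod>y\<in>X. f y (stay B y)) =
    (\<Prod>y\<in>X. if y \<le> int n then stay_prob p y * f y True + (1 - stay_prob p y) * f y False else f y False)"
    using assms(1,3)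
  proof (induction n arbitrary: X)
    case 0
    then show ?case by (auto simp: stay_def stay_prob_def intro!: prod.cong)
  next
    case (Suc n)
    let ?s = "int (Suc n)"
    let ?q = "p (Suc n)"
    let ?Y = "X - {?s}"
    have q: "?q \<in> {0..1}" using Suc.prems by simp
    have upd: "(\<Prod>y\<in>X. f y (stay (B(Suc n := c)) y)) =
       (if ?s \<in> X then f ?s c else 1) * (\<Prod>y\<in>?Y. f y (stay B y))" for B c
    proof -
      have "(\<Prod>y\<in>?Y. f y (stay (B(Suc n := c)) y)) = (\<Prod>y\<in>?Y. f y (stay B y))"
        by (intro prod.cong refl arg_cong2[where f = f]) (auto simp: stay_def)
      moreover have "stay (B(Suc n := c)) ?s = c" unfolding stay_def nat_int by simp
      ultimately show ?thesis using Suc.prems(2) by (auto simp: prod.remove[of X ?s])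
    qed
    let ?a = "if ?s \<in> X then ?q * f ?s True + (1 - ?q) * f ?s False else 1"
    have "measure_pmf.expectation (bern_vec p (Suc n)) (\<lambda>B. \<Prod>y\<in>X. f y (stay B y)) =
      measure_pmf.expectation (bern_vec p n) (\<lambda>B. ?a * (\<Prod>y\<in>?Y. f y (stay B y)))"
      unfolding expectation_bern_vec_Suc[of p n, OF q] upd
      by (intro Bochner_Integration.integral_cong refl) (auto simp: algebra_simps)
    also have "\<dots> = ?a * measure_pmf.expectation (bern_vec p n) (\<lambda>B. \<Prod>y\<in>?Y. f y (stay B y))"
      by simp
    also have "measure_pmf.expectation (bern_vec p n) (\<lambda>B. \<Prod>y\<in>?Y. f y (stay B y)) =
      (\<Prod>y\<in>?Y. if y \<le> int n then stay_prob p y * f y True + (1 - stay_prob p y) * f y False else f y False)"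
      using Suc.prems by (intro Suc.IH) auto
    also have "\<dots> = (\<Prod>y\<in>?Y. if y \<le> ?s then stay_prob p y * f y True + (1 - stay_prob p y) * f y False else f y False)"
      by (intro prod.cong refl) auto
    also have "?a * \<dots> = (\<Prod>y\<in>X. if y \<le> ?s then stay_prob p y * f y True + (1 - stay_prob p y) * f y False else f y False)"
    proof (cases "?s \<in> X")
      case True
      have "stay_prob p ?s = ?q" unfolding stay_prob_def nat_int by simp
      then show ?thesis using True Suc.prems(2) by (simp add: prod.remove[of X ?s])
    qed simp
    finally show ?case .
  qed
  also have "\<dots> = (\<Prod>y\<in>X. stay_prob p y * f y True + (1 - stay_prob p y) * f y False)"
    using assms(2) by (intro prod.cong refl) (auto simp: stay_prob_def)
  finally show ?thesis .
qed

section \<open>Evolution of heights and holes\<close>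

lemma site_update:
  assumes "admissible J \<eta> B"
  shows "real (site J (PEP_update J \<eta> B) (y + 1)) =
    real (site J \<eta> y) + of_bool (stay B (y + 1)) - of_bool (stay B y)"
proof -
  consider "y < 0" | "y = 0" | "y > 0" by linarith
  then show ?thesis
  proof cases
    case 1 then show ?thesis by (simp add: site_def stay_def)
  next
    case 2 then show ?thesis by (simp add: site_def stay_def PEP_update_def)
  next
    case 3
    define k where "k = nat y"
    have k: "y = int k" "k \<ge> 1" using 3 by (simp_all add: k_def)
    have n: "nat (int k + 1) = Suc k" by simp
    have "B k \<Longrightarrow> \<eta> k \<ge> 1" using assms k(2) by (auto simp: admissible_def Suc_le_eq)
    then show ?thesis using k(2) unfolding k(1) site_def stay_def n by (auto simp: PEP_update_def)
  qed
qed

lemma height_beyond: "x > int t \<Longrightarrow> height J t \<eta> x = 0"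
  by (simp add: height_def)

lemma height_rec:
  assumes "\<And>k. k > t \<Longrightarrow> \<eta> k = 0"
  shows "height J t \<eta> x = real (site J \<eta> x) + height J t \<eta> (x + 1)"
proof (cases "x \<le> int t")
  case True
  then have "{x..int t} = insert x {x + 1..int t}" by auto
  then show ?thesis by (simp add: height_def)
next
  case False
  then have "\<eta> (nat x) = 0" "x > 0" by (auto intro: assms)
  then show ?thesis using False by (simp add: height_def site_def)
qed

text \<open>Whatever sits at a site \<open>\<ge> x\<close> is at a site \<open>\<ge> x + 1\<close>
  one step later, except for the particle that stays at \<open>x\<close>, and nothing enters from
  the left. Formally the sum of \<open>site_update\<close> telescopes, and its upper end vanishes
  because nothing stays beyond \<open>t\<close>.\<close>

lemma height_update:
  assumes "admissible J \<eta> B" "\<And>k. B k \<Longrightarrow> k \<le> t"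
  shows "height J (Suc t) (PEP_update J \<eta> B) (x + 1) = height J t \<eta> x - of_bool (stay B x)"
proof (cases "x \<le> int t")
  case True
  have "height J (Suc t) (PEP_update J \<eta> B) (x + 1) =
      (\<Sum>y\<in>{x..int t}. real (site J (PEP_update J \<eta> B) (y + 1)))"
    unfolding height_def
    by (rule sum.reindex_bij_witness[of _ "\<lambda>y. y + 1" "\<lambda>y. y - 1"]) auto
  also have "\<dots> = height J t \<eta> x + (\<Sum>y\<in>{x..int t}. of_bool (stay B (y + 1)) - of_bool (stay B y))"
    unfolding height_def site_update[OF assms(1)] by (simp add: sum.distrib sum_subtractf)
  also have "(\<Sum>y\<in>{x..int t}. of_bool (stay B (y + 1)) - of_bool (stay B y)) =
      (of_bool (stay B (int t + 1)) - of_bool (stay B x) :: real)"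
    using True
  proof (induction rule: int_ge_induct)
    case (step i)
    have "{x..i + 1} = insert (i + 1) {x..i}" using step by auto
    then show ?case using step by simp
  qed simp
  finally have "height J (Suc t) (PEP_update J \<eta> B) (x + 1) =
      height J t \<eta> x + (of_bool (stay B (int t + 1)) - of_bool (stay B x))" .
  moreover have "\<not> stay B (int t + 1)" using assms(2)[of "Suc t"] by (auto simp: stay_def nat_add_distrib)
  ultimately show ?thesis by simp
next
  case False
  then have "\<not> stay B x" using assms(2)[of "nat x"] by (auto simp: stay_def)
  then show ?thesis using False by (simp add: height_beyond)
qed

lemma holes_update:
  assumes "admissible J \<eta> B" "\<And>k. B k \<Longrightarrow> k \<le> t"
  shows "holes J (Suc t) (PEP_update J \<eta> B) (x + 1) = holes J t \<eta> x + 1 - of_bool (stay B x)"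
  using height_update[OF assms, of x] by (simp add: holes_def algebra_simps)

lemma holes_rec:
  assumes "\<And>k. k > t \<Longrightarrow> \<eta> k = 0"
  shows "holes J t \<eta> (x + 1) = holes J t \<eta> x + real (J + 1) - real (site J \<eta> x)"
  using height_rec[of t \<eta> J x, OF assms] by (simp add: holes_def algebra_simps)

lemma pep_state_update:
  assumes s: "pep_state J t \<eta>" and a: "admissible J \<eta> B" and B: "\<And>k. B k \<Longrightarrow> k \<le> t"
  shows "pep_state J (Suc t) (PEP_update J \<eta> B)"
  unfolding pep_state_def
proof (intro conjI allI impI)
  fix k
  have \<eta>: "\<eta> j \<le> J + 1" for j using s by (auto simp: pep_state_def)
  have k1: "site J (PEP_update J \<eta> B) (int k) = PEP_update J \<eta> B k" if "k \<ge> 1" using that by (simp add: site_def)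
  have upd: "real (PEP_update J \<eta> B k) =
      real (site J \<eta> (int k - 1)) + of_bool (stay B (int k)) - of_bool (stay B (int k - 1))" if "k \<ge> 1"
    using site_update[OF a, of "int k - 1"] k1[OF that] by simp
  \<comment> \<open>A full site keeps one particle, so every site passes on at most
    \<open>J\<close>; with the one that may stay at the receiving site this gives the bound
    \<open>J + 1\<close>.\<close>
  have full: "stay B y" if "site J \<eta> y = J + 1" for y
  proof (cases "y \<le> 0")
    case False
    then have "nat y \<ge> 1" by simp
    then show ?thesis using a that False unfolding site_def stay_def admissible_def by auto
  qed (simp add: stay_def)
  show "PEP_update J \<eta> B k \<le> J + 1"
  proof (cases "k = 0")
    case True then show ?thesis by (simp add: PEP_update_def)
  next
    case False
    have "site J \<eta> (int k - 1) \<le> J + 1" using \<eta> by (simp add: site_def)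
    then have "real (site J \<eta> (int k - 1)) - of_bool (stay B (int k - 1)) \<le> real J"
      using full[of "int k - 1"] by (cases "site J \<eta> (int k - 1) = J + 1") auto
    then have "real (PEP_update J \<eta> B k) \<le> real J + 1" using upd False by auto
    then show ?thesis by linarith
  qed
  show "PEP_update J \<eta> B k = 0" if k: "Suc t < k"
  proof -
    have "\<not> stay B (int k)" using B[of k] k by (auto simp: stay_def)
    moreover have "site J \<eta> (int k - 1) = 0" using s k by (auto simp: site_def pep_state_def nat_diff_distrib)
    moreover have "\<not> stay B (int k - 1)" using B[of "k - 1"] k by (auto simp: stay_def nat_diff_distrib)
    ultimately have "real (PEP_update J \<eta> B k) = 0" using upd k by simp
    then show ?thesis by simp
  qed
next
  have "height J t \<eta> 0 = real (J + 1) + height J t \<eta> 1"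
    using height_rec[of t \<eta> J 0] s by (simp add: pep_state_def site_def)
  then show "height J (Suc t) (PEP_update J \<eta> B) 1 = real J * real (Suc t)"
    using height_update[OF a B, of 0] s by (simp add: stay_def pep_state_def algebra_simps)
qed

lemma admissible_support:
  assumes "pep_state J t \<eta>" "rate_ok J \<eta> p" "B \<in> set_pmf (bern_vec p (Suc t))"
  shows "admissible J \<eta> B" "B k \<Longrightarrow> k \<le> t"
proof -
  have p: "p k \<in> {0..1}" if "k \<in> {1..Suc t}" for k using assms(2) that by (auto simp: rate_ok_def)
  note sup = bern_vec_support[OF assms(3) p]
  show *: "admissible J \<eta> B" unfolding admissible_def
  proof (intro allI impI conjI)
    fix k :: nat assume k: "k \<ge> 1"
    show "\<eta> k \<noteq> 0" if "B k" using sup(1)[OF _ that] assms(2) k by (auto simp: rate_ok_def)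
    show "\<eta> k \<noteq> J + 1" if "\<not> B k"
    proof (cases "k \<le> Suc t")
      case True then show ?thesis using sup(2)[of k] that assms(2) k by (auto simp: rate_ok_def)
    next
      case False then show ?thesis using assms(1) by (auto simp: pep_state_def)
    qed
  qed
  show "k \<le> t" if "B k"
  proof (rule ccontr)
    assume "\<not> k \<le> t"
    then have "\<eta> k = 0" "k \<ge> 1" using assms(1) by (auto simp: pep_state_def)
    then show False using * that by (auto simp: admissible_def)
  qed
qed

section \<open>The chain with general rates: invariants and expectations\<close>

locale pep =
  fixes J :: nat and R :: "(nat \<Rightarrow> nat) \<Rightarrow> nat \<Rightarrow> real"
  assumes rate: "\<And>t \<eta>. pep_state J t \<eta> \<Longrightarrow> rate_ok J \<eta> (R \<eta>)"
begin

lemma chain_state: "\<eta> \<in> set_pmf (pep_chain J R t) \<Longrightarrow> pep_state J t \<eta>"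
proof (induction t arbitrary: \<eta>)
  case 0
  then show ?case by (simp add: pep_state_def height_def)
next
  case (Suc t)
  then obtain \<zeta> B where "\<zeta> \<in> set_pmf (pep_chain J R t)" "B \<in> set_pmf (bern_vec (R \<zeta>) (Suc t))"
    "\<eta> = PEP_update J \<zeta> B" by (auto simp del: bern_vec.simps)
  moreover from this have "pep_state J t \<zeta>" using Suc.IH by blast
  moreover from this have "rate_ok J \<zeta> (R \<zeta>)" by (rule rate)
  ultimately show ?case using admissible_support[of J t \<zeta> "R \<zeta>" B]
    by (auto intro!: pep_state_update simp del: bern_vec.simps)
qed

lemma finite_chain: "finite (set_pmf (pep_chain J R t))"
  by (induction t) (auto intro!: finite_bern_vec finite_imageI simp del: bern_vec.simps)

lemma integrable_chain [simp, intro]: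
  fixes g :: "(nat \<Rightarrow> nat) \<Rightarrow> real" shows "integrable (pep_chain J R t) g"
  by (rule integrable_measure_pmf_finite[OF finite_chain])

lemma chain_mono:
  fixes f g :: "(nat \<Rightarrow> nat) \<Rightarrow> real"
  assumes "\<And>\<eta>. pep_state J t \<eta> \<Longrightarrow> f \<eta> \<le> g \<eta>"
  shows "measure_pmf.expectation (pep_chain J R t) f \<le> measure_pmf.expectation (pep_chain J R t) g"
  using assms by (intro integral_mono_AE) (auto simp: AE_measure_pmf_iff dest: chain_state)

lemma chain_step:
  fixes g g' :: "(nat \<Rightarrow> nat) \<Rightarrow> real"
  assumes "\<And>\<eta>. pep_state J t \<eta> \<Longrightarrow>
     measure_pmf.expectation (bern_vec (R \<eta>) (Suc t)) (\<lambda>B. g (PEP_update J \<eta> B)) = g' \<eta>"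
  shows "measure_pmf.expectation (pep_chain J R (Suc t)) g = measure_pmf.expectation (pep_chain J R t) g'"
proof -
  have "measure_pmf.expectation (pep_chain J R (Suc t)) g = (\<Sum>\<eta>\<in>set_pmf (pep_chain J R t). pmf (pep_chain J R t) \<eta> *\<^sub>R
      measure_pmf.expectation (map_pmf (PEP_update J \<eta>) (bern_vec (R \<eta>) (Suc t))) g)"
    by (simp only: pep_chain.simps, subst pmf_expectation_bind[where A = "set_pmf (pep_chain J R t)"])
       (auto simp: finite_chain finite_bern_vec simp del: bern_vec.simps)
  also have "\<dots> = (\<Sum>\<eta>\<in>set_pmf (pep_chain J R t). pmf (pep_chain J R t) \<eta> *\<^sub>R g' \<eta>)"
    using assms chain_state by (intro sum.cong refl) (simp del: bern_vec.simps)
  also have "\<dots> = measure_pmf.expectation (pep_chain J R t) g'"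
    by (subst integral_measure_pmf[where A = "set_pmf (pep_chain J R t)"]) (auto simp: finite_chain)
  finally show ?thesis .
qed

end


subsection \<open>Duality\<close>

definition dual_fun :: "(nat \<Rightarrow> real \<Rightarrow> real \<Rightarrow> real) \<Rightarrow> nat \<Rightarrow> nat \<Rightarrow> (nat \<Rightarrow> nat) \<Rightarrow> nat \<Rightarrow> (nat \<Rightarrow> int) \<Rightarrow> real" where
  "dual_fun F J t \<eta> m x = (\<Prod>i<m. F i (height J t \<eta> (x i)) (holes J t \<eta> (x i)))"

definition occ :: "nat \<Rightarrow> (nat \<Rightarrow> int) \<Rightarrow> int \<Rightarrow> nat" where
  "occ m x y = card {i\<in>{..<m}. x i = y}"

text \<open>Points sitting at a common site form a block of consecutive indices; only the first point of a
  block may jump, which keeps the points weakly decreasing.\<close>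

definition move :: "(nat \<Rightarrow> int) \<Rightarrow> int set \<Rightarrow> nat \<Rightarrow> int" where
  "move x S i = (if x i \<in> S \<and> (\<forall>j<i. x j \<noteq> x i) then x i + 1 else x i)"

text \<open>These weights sum to one but can be negative once a block is longer than \<open>J + 1\<close>.\<close>

definition move_weight :: "nat \<Rightarrow> nat \<Rightarrow> (nat \<Rightarrow> int) \<Rightarrow> int set \<Rightarrow> real" where
  "move_weight J m x S = (\<Prod>y\<in>S. real (occ m x y) / real (J + 1)) *
     (\<Prod>y\<in>x ` {..<m} - S. 1 - real (occ m x y) / real (J + 1))"

text \<open>A jump has length one, so a lower block can at most catch up with a higher one; inside a
  block it is the smallest index that advances.\<close>

lemma antimono_move:
  assumes "antimono_on {..<m} x"
  shows "antimono_on {..<m} (move x S)"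
proof (rule monotone_onI)
  fix i j assume ij: "i \<in> {..<m}" "j \<in> {..<m}" "i \<le> j"
  then have "x j \<le> x i" using assms by (auto simp: monotone_on_def)
  moreover have "move x S j = x j" if "x i = x j" "i \<noteq> j"
    using that ij by (auto simp: move_def intro!: exI[of _ i])
  ultimately show "move x S j \<le> move x S i"
    by (cases "i = j"; cases "x i = x j") (auto simp: move_def)
qed

lemma antimono_fiber:
  fixes x :: "nat \<Rightarrow> int"
  assumes "antimono_on {..<m} x" "y \<in> x ` {..<m}"
  obtains c n where "{i\<in>{..<m}. x i = y} = {c..<c + n}" "n \<ge> 1" "n = occ m x y"
    "\<forall>i\<in>{c..<c + n}. (\<forall>j<i. x j \<noteq> x i) \<longleftrightarrow> i = c"
proof -
  define I where "I = {i\<in>{..<m}. x i = y}"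
  have I: "finite I" "I \<noteq> {}" using assms(2) by (auto simp: I_def)
  define c where "c = Min I"
  define d where "d = Max I"
  have c: "c \<in> I" "\<And>i. i \<in> I \<Longrightarrow> c \<le> i" using I by (auto simp: c_def)
  have d: "d \<in> I" "\<And>i. i \<in> I \<Longrightarrow> i \<le> d" using I by (auto simp: d_def)
  have conv: "i \<in> I" if i: "c \<le> i" "i \<le> d" for i
  proof -
    have m: "c < m" "d < m" "i < m" using i c(1) d(1) by (auto simp: I_def)
    then have "x d \<le> x i" "x i \<le> x c"
      using monotone_onD[OF assms(1), of i d] monotone_onD[OF assms(1), of c i] i by auto
    then show ?thesis using c(1) d(1) m(3) by (auto simp: I_def)
  qed
  have "I = {c..d}"
  proof (intro equalityI subsetI)
    fix i assume "i \<in> I"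
    then show "i \<in> {c..d}" using c(2)[of i] d(2)[of i] by simp
  next
    fix i assume "i \<in> {c..d}"
    then show "i \<in> I" using conv[of i] by simp
  qed
  moreover have cd: "c \<le> d" using c(2)[OF d(1)] .
  ultimately have eq: "I = {c..<c + (Suc d - c)}" by auto
  show ?thesis
  proof (rule that[of c "Suc d - c"])
    show "{i\<in>{..<m}. x i = y} = {c..<c + (Suc d - c)}" using eq by (simp add: I_def)
    show "Suc d - c \<ge> 1" using cd by simp
    show "Suc d - c = occ m x y" unfolding occ_def I_def[symmetric] by (subst eq) simp
    show "\<forall>i\<in>{c..<c + (Suc d - c)}. (\<forall>j<i. x j \<noteq> x i) \<longleftrightarrow> i = c"
    proof (intro ballI iffI)
      fix i assume i: "i \<in> {c..<c + (Suc d - c)}"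
      then have xi: "i \<in> I" using eq by simp
      assume "\<forall>j<i. x j \<noteq> x i"
      then show "i = c" using c(1) c(2)[OF xi] xi by (auto simp: I_def dest: le_neq_implies_less)
    next
      fix i assume i: "i \<in> {c..<c + (Suc d - c)}"
      then have xi: "i \<in> I" using eq by simp
      assume "i = c"
      show "\<forall>j<i. x j \<noteq> x i"
      proof (intro allI impI notI)
        fix j assume "j < i" "x j = x i"
        then have "j \<in> I" using xi by (auto simp: I_def)
        then show False using c(2)[of j] \<open>i = c\<close> \<open>j < i\<close> by simp
      qed
    qed
  qed
qed

text \<open>\<open>block\<close> is the duality relation at a single site. On the left the
  configuration moves: a staying particle lowers the height seen in the moving frame by 1, otherwise
  the hole count grows by 1. On the right the configuration is frozen and, with weight
  \<open>n / (J + 1)\<close>, the first point of the block steps to \<open>y + 1\<close>, where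
  height and holes are \<open>h - e\<close> and \<open>a + (J + 1) - e\<close>. The index
  \<open>c\<close> is free because a block may begin anywhere in the list of points.\<close>

locale pep_dual = pep +
  fixes F :: "nat \<Rightarrow> real \<Rightarrow> real \<Rightarrow> real"
  assumes block: "\<And>t \<eta> y c n h a e. \<lbrakk>pep_state J t \<eta>; n \<ge> 1;
      h = height J t \<eta> y; a = holes J t \<eta> y; e = real (site J \<eta> y)\<rbrakk> \<Longrightarrow>
    stay_prob (R \<eta>) y * (\<Prod>k\<in>{c..<c + n}. F k (h - 1) a)
      + (1 - stay_prob (R \<eta>) y) * (\<Prod>k\<in>{c..<c + n}. F k h (a + 1))
    = real n / real (J + 1) * (F c (h - e) (a + real (J + 1) - e) * (\<Prod>k\<in>{Suc c..<c + n}. F k h a))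
      + (1 - real n / real (J + 1)) * (\<Prod>k\<in>{c..<c + n}. F k h a)"
begin

text \<open>Group the factors by site. Stay variables at different sites are independent, so the
  expectation factorises and \<open>block\<close> applies to each site. Expanding the product of
  two-term sums yields one summand for each set \<open>S\<close> of sites whose block moves.\<close>

lemma bern_vec_dual_fun:
  assumes s: "pep_state J t \<eta>" and x: "antimono_on {..<m} x"
  shows "measure_pmf.expectation (bern_vec (R \<eta>) (Suc t))
      (\<lambda>B. dual_fun F J (Suc t) (PEP_update J \<eta> B) m (\<lambda>i. x i + 1))
    = (\<Sum>S\<in>Pow (x ` {..<m}). move_weight J m x S * dual_fun F J t \<eta> m (move x S))"
proof -
  define X where "X = x ` {..<m}"
  define I where "I y = {i\<in>{..<m}. x i = y}" for y
  let ?h = "height J t \<eta>" and ?a = "holes J t \<eta>" and ?q = "stay_prob (R \<eta>)"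
  let ?n = "\<lambda>y. real (occ m x y) / real (J + 1)"
  have X: "finite X" by (simp add: X_def)
  have z: "\<eta> k = 0" if "k > t" for k using s that by (auto simp: pep_state_def)
  have ok: "rate_ok J \<eta> (R \<eta>)" by (rule rate[OF s])
  have group: "(\<Prod>i<m. f i) = (\<Prod>y\<in>X. \<Prod>i\<in>I y. f i)" for f :: "nat \<Rightarrow> real"
    unfolding I_def X_def by (rule prod.group[symmetric]) auto
  define P where "P y b = (\<Prod>i\<in>I y. F i (?h y - of_bool b) (?a y + 1 - of_bool b))" for y b
  have "measure_pmf.expectation (bern_vec (R \<eta>) (Suc t))
      (\<lambda>B. dual_fun F J (Suc t) (PEP_update J \<eta> B) m (\<lambda>i. x i + 1))
    = measure_pmf.expectation (bern_vec (R \<eta>) (Suc t)) (\<lambda>B. \<Prod>y\<in>X. P y (stay B y))"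
  proof (rule integral_cong_AE)
    show "AE B in measure_pmf (bern_vec (R \<eta>) (Suc t)).
        dual_fun F J (Suc t) (PEP_update J \<eta> B) m (\<lambda>i. x i + 1) = (\<Prod>y\<in>X. P y (stay B y))"
      unfolding AE_measure_pmf_iff
    proof
      fix B assume B: "B \<in> set_pmf (bern_vec (R \<eta>) (Suc t))"
      note adm = admissible_support[OF s ok B]
      have "dual_fun F J (Suc t) (PEP_update J \<eta> B) m (\<lambda>i. x i + 1) =
         (\<Prod>i<m. F i (?h (x i) - of_bool (stay B (x i))) (?a (x i) + 1 - of_bool (stay B (x i))))"
        unfolding dual_fun_def by (simp add: height_update[OF adm] holes_update[OF adm])
      also have "\<dots> = (\<Prod>y\<in>X. P y (stay B y))"
        unfolding group P_def by (intro prod.cong refl) (auto simp: I_def)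
      finally show "dual_fun F J (Suc t) (PEP_update J \<eta> B) m (\<lambda>i. x i + 1) = (\<Prod>y\<in>X. P y (stay B y))" .
    qed
  qed simp_all
  also have "\<dots> = (\<Prod>y\<in>X. ?q y * P y True + (1 - ?q y) * P y False)"
    using ok z X by (intro expectation_bern_vec_prod) (auto simp: rate_ok_def)
  also have "\<dots> = (\<Prod>y\<in>X. ?n y * (\<Prod>i\<in>I y. F i (?h (move x {y} i)) (?a (move x {y} i)))
      + (1 - ?n y) * (\<Prod>i\<in>I y. F i (?h y) (?a y)))"
  proof (intro prod.cong refl)
    fix y assume y: "y \<in> X"
    obtain c n where cn: "I y = {c..<c + n}" "n \<ge> 1" "n = occ m x y"
       "\<forall>i\<in>{c..<c + n}. (\<forall>j<i. x j \<noteq> x i) \<longleftrightarrow> i = c"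
      unfolding I_def using antimono_fiber[OF x y[unfolded X_def]] by blast
    have xi: "x i = y" if "i \<in> {c..<c + n}" for i 
    proof -
      have "i \<in> I y" unfolding cn(1) by (rule that)
      then show ?thesis by (simp add: I_def)
    qed
    have mv: "move x {y} i = (if i = c then y + 1 else y)" if "i \<in> {c..<c + n}" for i
      unfolding move_def xi[OF that] using cn(4)[rule_format, OF that] xi[OF that] by simp
    have split: "{c..<c + n} = insert c {Suc c..<c + n}" using cn(2) by auto
    have "(\<Prod>i\<in>I y. F i (?h (move x {y} i)) (?a (move x {y} i))) =
      F c (?h (move x {y} c)) (?a (move x {y} c)) * (\<Prod>i\<in>{Suc c..<c + n}. F i (?h (move x {y} i)) (?a (move x {y} i)))"
      unfolding cn(1) split by simp
    also have "(\<Prod>i\<in>{Suc c..<c + n}. F i (?h (move x {y} i)) (?a (move x {y} i))) = (\<Prod>i\<in>{Suc c..<c + n}. F i (?h y) (?a y))"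
      by (intro prod.cong refl) (simp add: mv)
    also have "move x {y} c = y + 1" using mv[of c] cn(2) by simp
    also have "?h (y + 1) = ?h y - real (site J \<eta> y)" using height_rec[of t \<eta> J y, OF z] by simp
    also have "?a (y + 1) = ?a y + real (J + 1) - real (site J \<eta> y)" by (rule holes_rec[of t \<eta> J y, OF z])
    finally have mv_prod: "(\<Prod>i\<in>I y. F i (?h (move x {y} i)) (?a (move x {y} i))) =
       F c (?h y - real (site J \<eta> y)) (?a y + real (J + 1) - real (site J \<eta> y)) * (\<Prod>i\<in>{Suc c..<c + n}. F i (?h y) (?a y))" .
    show "?q y * P y True + (1 - ?q y) * P y False =
      ?n y * (\<Prod>i\<in>I y. F i (?h (move x {y} i)) (?a (move x {y} i))) + (1 - ?n y) * (\<Prod>i\<in>I y. F i (?h y) (?a y))"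
      unfolding mv_prod using block[OF s cn(2) refl refl refl, of y c] by (simp add: P_def cn(1) cn(3)[symmetric])
  qed
  also have "\<dots> = (\<Sum>S\<in>Pow X. (\<Prod>y\<in>S. ?n y * (\<Prod>i\<in>I y. F i (?h (move x {y} i)) (?a (move x {y} i)))) *
      (\<Prod>y\<in>X - S. (1 - ?n y) * (\<Prod>i\<in>I y. F i (?h y) (?a y))))"
    by (rule prod_add[OF X])
  also have "\<dots> = (\<Sum>S\<in>Pow X. move_weight J m x S * dual_fun F J t \<eta> m (move x S))"
  proof (intro sum.cong refl)
    fix S assume S: "S \<in> Pow X"
    have "dual_fun F J t \<eta> m (move x S) = (\<Prod>y\<in>X. \<Prod>i\<in>I y. F i (?h (move x S i)) (?a (move x S i)))"
      unfolding dual_fun_def by (rule group)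
    also have "\<dots> = (\<Prod>y\<in>S. \<Prod>i\<in>I y. F i (?h (move x S i)) (?a (move x S i)))
        * (\<Prod>y\<in>X - S. \<Prod>i\<in>I y. F i (?h (move x S i)) (?a (move x S i)))"
      using S X by (simp add: prod.subset_diff mult.commute)
    also have "(\<Prod>y\<in>S. \<Prod>i\<in>I y. F i (?h (move x S i)) (?a (move x S i))) =
        (\<Prod>y\<in>S. \<Prod>i\<in>I y. F i (?h (move x {y} i)) (?a (move x {y} i)))"
      by (intro prod.cong refl) (auto simp: I_def move_def)
    also have "(\<Prod>y\<in>X - S. \<Prod>i\<in>I y. F i (?h (move x S i)) (?a (move x S i))) =
        (\<Prod>y\<in>X - S. \<Prod>i\<in>I y. F i (?h y) (?a y))"
      by (intro prod.cong refl) (auto simp: I_def move_def)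
    finally show "(\<Prod>y\<in>S. ?n y * (\<Prod>i\<in>I y. F i (?h (move x {y} i)) (?a (move x {y} i)))) *
      (\<Prod>y\<in>X - S. (1 - ?n y) * (\<Prod>i\<in>I y. F i (?h y) (?a y)))
      = move_weight J m x S * dual_fun F J t \<eta> m (move x S)"
      unfolding move_weight_def X_def[symmetric] prod.distrib by (simp only: mult_ac)
  qed
  finally show ?thesis by (simp only: X_def)
qed

lemma chain_dual_fun:
  assumes "antimono_on {..<m} x"
  shows "measure_pmf.expectation (pep_chain J R (Suc t)) (\<lambda>\<eta>. dual_fun F J (Suc t) \<eta> m (\<lambda>i. x i + 1))
    = (\<Sum>S\<in>Pow (x ` {..<m}). move_weight J m x S *
        measure_pmf.expectation (pep_chain J R t) (\<lambda>\<eta>. dual_fun F J t \<eta> m (move x S)))"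
  by (subst chain_step[OF bern_vec_dual_fun[OF _ assms]]) auto

end

text \<open>Both expectations obey \<open>chain_dual_fun\<close> with the same weights, so a
  constant ratio at time 0 persists. Since \<open>move\<close> changes the points, the induction has
  to range over all weakly decreasing \<open>x\<close>.\<close>

theorem pep_duality:
  assumes "pep_dual J R F" "pep_dual J R' F'"
    and init: "\<And>x. antimono_on {..<m} x \<Longrightarrow> dual_fun F J 0 (\<lambda>_. 0) m x = C * dual_fun F' J 0 (\<lambda>_. 0) m x"
    and "antimono_on {..<m} x"
  shows "measure_pmf.expectation (pep_chain J R t) (\<lambda>\<eta>. dual_fun F J t \<eta> m x) =
    C * measure_pmf.expectation (pep_chain J R' t) (\<lambda>\<eta>. dual_fun F' J t \<eta> m x)"
  using assms(4)
proof (induction t arbitrary: x)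
  case 0
  then show ?case by (simp add: init)
next
  case (Suc t)
  interpret P: pep_dual J R F by fact
  interpret P': pep_dual J R' F' by fact
  define z where "z i = x i - 1" for i
  have z: "antimono_on {..<m} z" 
  proof (rule monotone_onI)
    fix i j assume "i \<in> {..<m}" "j \<in> {..<m}" "i \<le> j"
    then show "z j \<le> z i" using monotone_onD[OF Suc.prems, of i j] by (simp add: z_def)
  qed
  have x: "x = (\<lambda>i. z i + 1)" by (simp add: z_def)
  show ?case
    unfolding x P.chain_dual_fun[OF z] P'.chain_dual_fun[OF z] sum_distrib_left
    using Suc.IH[OF antimono_move[OF z]] by (intro sum.cong refl) simp
qed


subsection \<open>The dynamic and the static process\<close>

lemma height_eq_nat_sum: "x \<ge> 1 \<Longrightarrow> height J t \<eta> x = (\<Sum>j\<in>{nat x..t}. real (\<eta> j))"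
  unfolding height_def
  by (rule sum.reindex_bij_witness[of _ int nat]) (auto simp: site_def)

lemma PEP_h_eq_height:
  assumes "pep_state J t \<eta>" "x \<ge> 1"
  shows "real (PEP_h \<eta> x) = height J t \<eta> x"
proof -
  have z: "\<eta> k = 0" if "k > t" for k using assms(1) that by (auto simp: pep_state_def)
  have "PEP_h \<eta> x = (\<Sum>j\<in>{nat x..t}. \<eta> j)"
    unfolding PEP_h_def
  proof (rule sum.mono_neutral_left)
    show "{j. 1 \<le> j \<and> x \<le> int j \<and> \<eta> j \<noteq> 0} \<subseteq> {nat x..t}"
    proof
      fix j assume "j \<in> {j. 1 \<le> j \<and> x \<le> int j \<and> \<eta> j \<noteq> 0}"
      then have "\<not> j > t" "x \<le> int j" using z[of j] by auto
      then show "j \<in> {nat x..t}" by auto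
    qed
    show "\<forall>j\<in>{nat x..t} - {j. 1 \<le> j \<and> x \<le> int j \<and> \<eta> j \<noteq> 0}. \<eta> j = 0"
      using assms(2) by (auto simp: nat_le_iff)
  qed simp
  then show ?thesis using assms(2) by (simp add: height_eq_nat_sum)
qed

lemma PEP_a_eq_holes:
  assumes "pep_state J t \<eta>" "k \<ge> 1"
  shows "PEP_a J \<eta> k = holes J t \<eta> (int k)"
  using assms(2)
proof (induction k rule: nat_induct_at_least)
  case base
  then show ?case using assms(1) by (simp add: PEP_a_def holes_def pep_state_def)
next
  case (Suc k)
  have z: "\<eta> k = 0" if "k > t" for k using assms(1) that by (auto simp: pep_state_def)
  have "PEP_a J \<eta> (Suc k) = PEP_a J \<eta> k + (real (J + 1) - real (\<eta> k))"
    using Suc.hyps by (simp add: PEP_a_def)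
  then show ?case using Suc holes_rec[of t \<eta> J "int k", OF z] by (simp add: site_def add.commute)
qed

lemma PEP_a_nonneg: "pep_state J t \<eta> \<Longrightarrow> PEP_a J \<eta> k \<ge> 0"
  unfolding PEP_a_def by (intro sum_nonneg) (auto simp: pep_state_def simp flip: of_nat_Suc)

lemma holes_nonneg: "pep_state J t \<eta> \<Longrightarrow> x \<ge> 1 \<Longrightarrow> holes J t \<eta> x \<ge> 0"
  using PEP_a_eq_holes[of J t \<eta> "nat x"] PEP_a_nonneg[of J t \<eta> "nat x"] by simp

text \<open>Shifting the argument by one exchanges just one end factor, so all products over a block
  share the factors from \<open>Suc c\<close> on.\<close>

lemma prod_linear_shift:
  fixes u :: real
  assumes "n \<ge> 1"
  shows "(\<Prod>k\<in>{c..<c + n}. u - real k) = (u - real c) * (\<Prod>k\<in>{Suc c..<c + n}. u - real k)"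
    and "(\<Prod>k\<in>{c..<c + n}. u - 1 - real k) = (u - real (c + n)) * (\<Prod>k\<in>{Suc c..<c + n}. u - real k)"
    and "(\<Prod>k\<in>{c..<c + n}. u + real k) = (u + real c) * (\<Prod>k\<in>{Suc c..<c + n}. u + real k)"
    and "(\<Prod>k\<in>{c..<c + n}. u + 1 + real k) = (u + real (c + n)) * (\<Prod>k\<in>{Suc c..<c + n}. u + real k)"
proof -
  have lo: "{c..<c + n} = insert c {Suc c..<c + n}" using assms by auto
  have hi: "{Suc c..<Suc (c + n)} = insert (c + n) {Suc c..<c + n}" using assms by auto
  show "(\<Prod>k\<in>{c..<c + n}. u - real k) = (u - real c) * (\<Prod>k\<in>{Suc c..<c + n}. u - real k)"
    "(\<Prod>k\<in>{c..<c + n}. u + real k) = (u + real c) * (\<Prod>k\<in>{Suc c..<c + n}. u + real k)"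
    unfolding lo by simp_all
  have "(\<Prod>k\<in>{c..<c + n}. u - 1 - real k) = (\<Prod>k\<in>{Suc c..<Suc (c + n)}. u - real k)"
    "(\<Prod>k\<in>{c..<c + n}. u + 1 + real k) = (\<Prod>k\<in>{Suc c..<Suc (c + n)}. u + real k)"
    unfolding prod.shift_bounds_Suc_ivl by (auto intro!: prod.cong)
  then show "(\<Prod>k\<in>{c..<c + n}. u - 1 - real k) = (u - real (c + n)) * (\<Prod>k\<in>{Suc c..<c + n}. u - real k)"
    "(\<Prod>k\<in>{c..<c + n}. u + 1 + real k) = (u + real (c + n)) * (\<Prod>k\<in>{Suc c..<c + n}. u + real k)"
    unfolding hi by simp_all
qed

definition dyn_factor :: "real \<Rightarrow> nat \<Rightarrow> real \<Rightarrow> real \<Rightarrow> real" where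
  "dyn_factor \<gamma> k h a = (h - real k) * (a + \<gamma> + real k)"

definition static_factor :: "nat \<Rightarrow> real \<Rightarrow> real \<Rightarrow> real" where
  "static_factor k h a = h - real k"

text \<open>The limit \<open>\<gamma> \<rightarrow> \<infinity>\<close> of \<open>PEP_p\<close>.\<close>

definition static_rate :: "nat \<Rightarrow> (nat \<Rightarrow> nat) \<Rightarrow> nat \<Rightarrow> real" where
  "static_rate J \<eta> k = real (\<eta> k) / real (J + 1)"

text \<open>After the common factor \<open>P\<close> is split off, an identity quadratic in
  \<open>h\<close> and \<open>A\<close> remains. Prescribing \<open>q\<close> only through its
  product with \<open>\<gamma> + h + a\<close> lets the lemma cover the reservoir sites too, where
  \<open>q = 1\<close> and \<open>e = K\<close>.\<close>

lemma dyn_block_identity: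
  fixes h a e q K \<gamma> :: real
  assumes n: "n \<ge> 1" and K: "K \<noteq> 0" and q: "q * (\<gamma> + h + a) = e / K * (K - e + (\<gamma> + h + a))"
  shows "q * (\<Prod>k\<in>{c..<c + n}. dyn_factor \<gamma> k (h - 1) a) + (1 - q) * (\<Prod>k\<in>{c..<c + n}. dyn_factor \<gamma> k h (a + 1))
    = real n / K * (dyn_factor \<gamma> c (h - e) (a + K - e) * (\<Prod>k\<in>{Suc c..<c + n}. dyn_factor \<gamma> k h a))
      + (1 - real n / K) * (\<Prod>k\<in>{c..<c + n}. dyn_factor \<gamma> k h a)"
proof -
  define A P where "A = a + \<gamma>" and
    "P = (\<Prod>k\<in>{Suc c..<c + n}. h - real k) * (\<Prod>k\<in>{Suc c..<c + n}. A + real k)"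
  have 1: "(\<Prod>k\<in>{c..<c + n}. dyn_factor \<gamma> k (h - 1) a) = (h - real (c + n)) * (A + real c) * P"
    "(\<Prod>k\<in>{c..<c + n}. dyn_factor \<gamma> k h (a + 1)) = (h - real c) * (A + real (c + n)) * P"
    "(\<Prod>k\<in>{c..<c + n}. dyn_factor \<gamma> k h a) = (h - real c) * (A + real c) * P"
    "(\<Prod>k\<in>{Suc c..<c + n}. dyn_factor \<gamma> k h a) = P"
    "dyn_factor \<gamma> c (h - e) (a + K - e) = (h - e - real c) * (A + K - e + real c)"
  proof -
    have d: "dyn_factor \<gamma> k (h - 1) a = (h - 1 - real k) * (A + real k)"
      "dyn_factor \<gamma> k h (a + 1) = (h - real k) * (A + 1 + real k)"
      "dyn_factor \<gamma> k h a = (h - real k) * (A + real k)"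
      "dyn_factor \<gamma> k (h - e) (a + K - e) = (h - e - real k) * (A + K - e + real k)" for k
      by (simp_all add: dyn_factor_def A_def)
    note ps = prod_linear_shift[OF n, of h c] prod_linear_shift[OF n, of A c]
    show "(\<Prod>k\<in>{c..<c + n}. dyn_factor \<gamma> k (h - 1) a) = (h - real (c + n)) * (A + real c) * P"
      "(\<Prod>k\<in>{c..<c + n}. dyn_factor \<gamma> k h (a + 1)) = (h - real c) * (A + real (c + n)) * P"
      "(\<Prod>k\<in>{c..<c + n}. dyn_factor \<gamma> k h a) = (h - real c) * (A + real c) * P"
      "(\<Prod>k\<in>{Suc c..<c + n}. dyn_factor \<gamma> k h a) = P"
      "dyn_factor \<gamma> c (h - e) (a + K - e) = (h - e - real c) * (A + K - e + real c)"
      unfolding d prod.distrib ps P_def by (simp_all only: mult_ac)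
  qed
  have q': "q * (h + A) = e / K * (K - e + (h + A))" using q by (simp add: A_def algebra_simps)
  have "q * ((h - real (c + n)) * (A + real c)) + (1 - q) * ((h - real c) * (A + real (c + n)))
    = (h - real c) * (A + real c) + real n * (h - real c) - real n * (q * (h + A))"
    by (simp add: algebra_simps)
  also have "\<dots> = real n / K * ((h - e - real c) * (A + K - e + real c)) + (1 - real n / K) * ((h - real c) * (A + real c))"
    unfolding q' using K by (simp add: field_simps)
  finally have eq: "q * ((h - real (c + n)) * (A + real c)) + (1 - q) * ((h - real c) * (A + real (c + n)))
    = real n / K * ((h - e - real c) * (A + K - e + real c)) + (1 - real n / K) * ((h - real c) * (A + real c))" .
  show ?thesis unfolding 1 using arg_cong[OF eq, of "\<lambda>z. z * P"]
    by (simp only: distrib_right mult.assoc)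
qed

lemma static_block_identity:
  fixes h a e K :: real
  assumes n: "n \<ge> 1" and K: "K \<noteq> 0"
  shows "e / K * (\<Prod>k\<in>{c..<c + n}. static_factor k (h - 1) a) + (1 - e / K) * (\<Prod>k\<in>{c..<c + n}. static_factor k h (a + 1))
    = real n / K * (static_factor c (h - e) (a + K - e) * (\<Prod>k\<in>{Suc c..<c + n}. static_factor k h a))
      + (1 - real n / K) * (\<Prod>k\<in>{c..<c + n}. static_factor k h a)"
proof -
  define P where "P = (\<Prod>k\<in>{Suc c..<c + n}. h - real k)"
  have eq: "e / K * (h - real (c + n)) + (1 - e / K) * (h - real c) = real n / K * (h - e - real c) + (1 - real n / K) * (h - real c)"
    using K by (simp add: field_simps)
  show ?thesis
    unfolding static_factor_def prod_linear_shift(2)[OF n, of h c] prod_linear_shift(1)[OF n, of h c] P_def[symmetric]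
    using arg_cong[OF eq, of "\<lambda>z. z * P"] by (simp only: distrib_right mult.assoc)
qed

lemma pep_dyn:
  assumes \<gamma>: "\<gamma> > real J + 1"
  shows "pep_dual J (PEP_p J \<gamma>) (dyn_factor \<gamma>)"
proof
  fix t \<eta> assume s: "pep_state J t \<eta>"
  show "rate_ok J \<eta> (PEP_p J \<gamma> \<eta>)"
    unfolding rate_ok_def
  proof (intro allI impI)
    fix k :: nat assume "k \<ge> 1"
    define U where "U = PEP_Upsilon J \<gamma> \<eta> k"
    have U: "U > real J + 1"
      using \<gamma> PEP_a_nonneg[OF s, of k] by (simp add: U_def PEP_Upsilon_def)
    have "\<eta> k \<le> J + 1" using s by (simp add: pep_state_def)
    then have e: "real (\<eta> k) \<le> real J + 1" by linarith
    \<comment> \<open>The probability is at most 1 exactly when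
      \<open>(J + 1 - \<eta> k) * (U - \<eta> k)\<close> is nonnegative, and here
      \<open>U > J + 1 \<ge> \<eta> k\<close>.\<close>
    have "real (\<eta> k) * ((real J + 1) - real (\<eta> k)) \<le> U * ((real J + 1) - real (\<eta> k))"
      using U e by (intro mult_right_mono) auto
    then have "real (\<eta> k) * (U + (real J + 1 - real (\<eta> k))) \<le> (real J + 1) * U"
      by (simp add: algebra_simps)
    moreover have "PEP_p J \<gamma> \<eta> k = real (\<eta> k) * (U + (real J + 1 - real (\<eta> k))) / ((real J + 1) * U)"
      unfolding PEP_p_def U_def[symmetric] using U by (simp add: divide_simps) (simp add: algebra_simps)
    ultimately have "PEP_p J \<gamma> \<eta> k \<le> 1" using U by simp
    moreover have "PEP_p J \<gamma> \<eta> k \<ge> 0"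
      unfolding PEP_p_def U_def[symmetric] using U e by (intro mult_nonneg_nonneg add_nonneg_nonneg divide_nonneg_nonneg) auto
    ultimately show "0 \<le> PEP_p J \<gamma> \<eta> k \<and> PEP_p J \<gamma> \<eta> k \<le> 1 \<and> (\<eta> k = 0 \<longrightarrow> PEP_p J \<gamma> \<eta> k = 0) \<and>
        (\<eta> k = J + 1 \<longrightarrow> PEP_p J \<gamma> \<eta> k = 1)" by (simp add: PEP_p_def)
  qed
next
  fix t \<eta> and n c :: nat and y h a e
  assume s: "pep_state J t \<eta>" and n: "n \<ge> 1"
    and h: "h = height J t \<eta> y" and a: "a = holes J t \<eta> y" and e: "e = real (site J \<eta> y)"
  have q: "stay_prob (PEP_p J \<gamma> \<eta>) y * (\<gamma> + h + a) = e / real (J + 1) * (real (J + 1) - e + (\<gamma> + h + a))"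
  proof (cases "y \<le> 0")
    case True
    then show ?thesis by (simp add: stay_prob_def e site_def)
  next
    case False
    have U: "PEP_Upsilon J \<gamma> \<eta> (nat y) = \<gamma> + h + a"
      using False s PEP_h_eq_height[of J t \<eta> y] PEP_a_eq_holes[of J t \<eta> "nat y"]
      by (simp add: PEP_Upsilon_def h a)
    have pos: "\<gamma> + h + a > 0"
      using U[symmetric] \<gamma> PEP_a_nonneg[OF s, of "nat y"] by (simp add: PEP_Upsilon_def)
    have "stay_prob (PEP_p J \<gamma> \<eta>) y = e / real (J + 1) * (1 + (real (J + 1) - e) / (\<gamma> + h + a))"
      using False by (simp add: stay_prob_def PEP_p_def U e site_def)
    moreover have "(1 + (real (J + 1) - e) / (\<gamma> + h + a)) * (\<gamma> + h + a) = real (J + 1) - e + (\<gamma> + h + a)"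
      using pos by (simp add: distrib_right)
    ultimately show ?thesis by (simp only: mult.assoc)
  qed
  show "stay_prob (PEP_p J \<gamma> \<eta>) y * (\<Prod>k\<in>{c..<c + n}. dyn_factor \<gamma> k (h - 1) a)
      + (1 - stay_prob (PEP_p J \<gamma> \<eta>) y) * (\<Prod>k\<in>{c..<c + n}. dyn_factor \<gamma> k h (a + 1))
    = real n / real (J + 1) * (dyn_factor \<gamma> c (h - e) (a + real (J + 1) - e) * (\<Prod>k\<in>{Suc c..<c + n}. dyn_factor \<gamma> k h a))
      + (1 - real n / real (J + 1)) * (\<Prod>k\<in>{c..<c + n}. dyn_factor \<gamma> k h a)"
    by (rule dyn_block_identity[OF n _ q]) simp
qed

lemma pep_static: "pep_dual J (static_rate J) static_factor"
proof
  fix t \<eta> assume s: "pep_state J t \<eta>"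
  then have "\<eta> k \<le> J + 1" for k by (simp add: pep_state_def)
  then have "real (\<eta> k) \<le> real J + 1" for k by (metis of_nat_1 of_nat_add of_nat_mono)
  then show "rate_ok J \<eta> (static_rate J \<eta>)" by (simp add: rate_ok_def static_rate_def field_simps)
next
  fix t \<eta> and n c :: nat and y h a e
  assume "pep_state J t \<eta>" and n: "n \<ge> 1" and e: "e = real (site J \<eta> y)"
  have q: "stay_prob (static_rate J \<eta>) y = e / real (J + 1)"
    by (simp add: stay_prob_def static_rate_def site_def e)
  show "stay_prob (static_rate J \<eta>) y * (\<Prod>k\<in>{c..<c + n}. static_factor k (h - 1) a)
      + (1 - stay_prob (static_rate J \<eta>) y) * (\<Prod>k\<in>{c..<c + n}. static_factor k h (a + 1))
    = real n / real (J + 1) * (static_factor c (h - e) (a + real (J + 1) - e) * (\<Prod>k\<in>{Suc c..<c + n}. static_factor k h a))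
      + (1 - real n / real (J + 1)) * (\<Prod>k\<in>{c..<c + n}. static_factor k h a)"
    unfolding q by (rule static_block_identity[OF n]) simp
qed

lemma height_initial: "height J 0 (\<lambda>_. 0) x = real (J + 1) * max 0 (1 - of_int x)"
proof -
  have "height J 0 (\<lambda>_. 0) x = (\<Sum>y\<in>{x..0}. real (J + 1))"
    unfolding height_def by (intro sum.cong) (auto simp: site_def)
  then show ?thesis by (simp add: max_def)
qed

text \<open>If all points are at most 1, every hole count is 0 and the extra factors are
  \<open>\<gamma> + i\<close>. Otherwise the first point, being the largest, lies beyond 1, where
  the height is 0, and its unshifted factor kills both sides; here the ordering of the points is
  essential.\<close>

lemma dyn_static_initial:
  assumes x: "antimono_on {..<m} x"
  shows "dual_fun (dyn_factor \<gamma>) J 0 (\<lambda>_. 0) m x = pochhammer \<gamma> m * dual_fun static_factor J 0 (\<lambda>_. 0) m x"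
proof (cases "\<forall>i<m. x i \<le> 1")
  case True
  then have "holes J 0 (\<lambda>_. 0) (x i) = 0" if "i < m" for i
    using that by (auto simp: holes_def height_initial max_def algebra_simps)
  then show ?thesis
    by (simp add: dual_fun_def dyn_factor_def static_factor_def prod.distrib pochhammer_prod lessThan_atLeast0)
next
  case False
  then obtain i where i: "i < m" "x i > 1" by force
  then have "x i \<le> x 0" using monotone_onD[OF x, of 0 i] by simp
  then have "height J 0 (\<lambda>_. 0) (x 0) = 0" using i by (simp add: height_initial)
  then have "dual_fun (dyn_factor \<gamma>) J 0 (\<lambda>_. 0) m x = 0" "dual_fun static_factor J 0 (\<lambda>_. 0) m x = 0"
    unfolding dual_fun_def using i(1)
    by (auto simp: dyn_factor_def static_factor_def intro!: prod_zero bexI[of _ 0])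
  then show ?thesis by simp
qed

theorem dyn_static_moments:
  assumes "\<gamma> > real J + 1"
  shows "measure_pmf.expectation (PEP_dist J \<gamma> t)
      (\<lambda>\<eta>. \<Prod>i<m. (height J t \<eta> x - real i) * (holes J t \<eta> x + \<gamma> + real i))
    = pochhammer \<gamma> m * measure_pmf.expectation (pep_chain J (static_rate J) t) (\<lambda>\<eta>. \<Prod>i<m. height J t \<eta> x - real i)"
  using pep_duality[OF pep_dyn[OF assms] pep_static dyn_static_initial, of m "\<lambda>_. x" t]
  by (simp add: dual_fun_def dyn_factor_def static_factor_def PEP_dist_eq_chain monotone_on_def)

text \<open>For a single point the duality is a random walk: going back one time step, the point
  moves from \<open>x\<close> to \<open>x - 1\<close> with probability \<open>J / (J + 1)\<close>
  and else remains. At time 0 it sits at \<open>x\<close> minus a binomial variable, and the initial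
  height there is explicit.\<close>

lemma static_mean:
  "measure_pmf.expectation (pep_chain J (static_rate J) t) (\<lambda>\<eta>. height J t \<eta> x) =
   real (J + 1) * measure_pmf.expectation (binomial_pmf t (real J / real (J + 1))) (\<lambda>k. max 0 (1 - of_int x + real k))"
proof (induction t arbitrary: x)
  case 0
  then show ?case by (simp add: height_initial binomial_pmf_0)
next
  case (Suc t)
  interpret pep_dual J "static_rate J" static_factor by (rule pep_static)
  let ?p = "real J / real (J + 1)"
  have p: "?p \<in> {0..1}" by simp
  have "antimono_on {..<Suc 0} (\<lambda>_::nat. x - 1)" by (simp add: monotone_on_def)
  from chain_dual_fun[OF this, of t]
  have "measure_pmf.expectation (pep_chain J (static_rate J) (Suc t)) (\<lambda>\<eta>. height J (Suc t) \<eta> x) =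
    ?p * measure_pmf.expectation (pep_chain J (static_rate J) t) (\<lambda>\<eta>. height J t \<eta> (x - 1))
    + (1 - ?p) * measure_pmf.expectation (pep_chain J (static_rate J) t) (\<lambda>\<eta>. height J t \<eta> x)"
    by (simp add: dual_fun_def static_factor_def Pow_insert move_weight_def occ_def move_def field_simps lessThan_Suc
        del: pep_chain.simps)
  moreover have "(\<lambda>k. max 0 (1 - of_int (x - 1) + real k)) = (\<lambda>k. max 0 (1 - of_int x + real (Suc k)))"
    by (simp add: algebra_simps)
  ultimately show ?case unfolding Suc.IH expectation_binomial_step[OF p] by (simp only: distrib_left mult.left_commute)
qed


subsection \<open>Concentration of the static height\<close>

lemma expectation_bern_vec_prod_nat:
  fixes f :: "nat \<Rightarrow> bool \<Rightarrow> real"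
  assumes "\<And>k. k \<in> {1..n} \<Longrightarrow> p k \<in> {0..1}" "\<And>k. k > n \<Longrightarrow> p k = 0" "finite X" "0 \<notin> X"
  shows "measure_pmf.expectation (bern_vec p n) (\<lambda>B. \<Prod>k\<in>X. f k (B k)) =
    (\<Prod>k\<in>X. p k * f k True + (1 - p k) * f k False)"
proof -
  have X: "k > 0" if "k \<in> X" for k using that assms(4) by (cases k) auto
  have "measure_pmf.expectation (bern_vec p n) (\<lambda>B. \<Prod>y\<in>int ` X. f (nat y) (stay B y)) =
    (\<Prod>y\<in>int ` X. stay_prob p y * f (nat y) True + (1 - stay_prob p y) * f (nat y) False)"
    using assms by (intro expectation_bern_vec_prod) auto
  moreover have "(\<Prod>y\<in>int ` X. f (nat y) (stay B y)) = (\<Prod>k\<in>X. f k (B k))" for B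
    unfolding prod.reindex[OF inj_on_of_nat] by (intro prod.cong) (auto simp: stay_def dest: X)
  moreover have "(\<Prod>y\<in>int ` X. stay_prob p y * f (nat y) True + (1 - stay_prob p y) * f (nat y) False) =
    (\<Prod>k\<in>X. p k * f k True + (1 - p k) * f k False)"
    unfolding prod.reindex[OF inj_on_of_nat] by (intro prod.cong) (auto simp: stay_prob_def dest: X)
  ultimately show ?thesis by simp
qed

lemma PEP_update_Suc:
  assumes "admissible J \<eta> B"
  shows "PEP_update J \<eta> B (Suc k) =
    (if k = 0 then J else \<eta> k - of_bool (B k)) + of_bool (B (Suc k))"
proof (cases "k = 0")
  case True
  then show ?thesis by (simp add: PEP_update_def nat_add_distrib)
next
  case False
  then have "B k \<Longrightarrow> \<eta> k \<ge> 1" using assms by (auto simp: admissible_def Suc_le_eq)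
  then show ?thesis using False by (auto simp: PEP_update_def nat_diff_distrib)
qed

text \<open>Left: the mean weight produced by \<open>n\<close> particles at a site when one of them
  stays with probability \<open>n / K\<close> and otherwise none. Right: the same for
  \<open>n\<close> particles that stay independently with probability \<open>1 / K\<close> each.
  Dividing by \<open>v ^ n\<close> turns this into Bernoulli's inequality.\<close>

lemma weighted_power_bernoulli:
  fixes u v :: real
  assumes "u > 0" "v > 0" "K \<ge> 1"
  shows "real n / K * (v ^ (n - 1) * u) + (1 - real n / K) * v ^ n \<le> (v + (u - v) / K) ^ n"
proof (cases n)
  case (Suc l)
  define d where "d = (u - v) / (K * v)"
  have "u / (K * v) > 0" "1 / K \<le> 1" using assms by simp_all
  moreover have "d = u / (K * v) - 1 / K" using assms by (simp add: d_def diff_divide_distrib)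
  ultimately have d: "d \<ge> -1" by linarith
  have "real n / K * (v ^ (n - 1) * u) + (1 - real n / K) * v ^ n = v ^ n * (1 + real n * d)"
    using assms Suc by (simp add: d_def field_simps)
  also have "\<dots> \<le> v ^ n * (1 + d) ^ n"
    using assms by (intro mult_left_mono Bernoulli_inequality d) auto
  also have "\<dots> = (v + (u - v) / K) ^ n"
    using assms by (simp add: d_def power_mult_distrib[symmetric] distrib_left)
  finally show ?thesis .
qed simp

text \<open>The mean of \<open>w\<close> after one step of a lone particle that starts at
  \<open>k\<close>, stays with probability \<open>1 / (J + 1)\<close> and otherwise moves to
  \<open>k + 1\<close>.\<close>

definition pull_back :: "nat \<Rightarrow> (nat \<Rightarrow> real) \<Rightarrow> nat \<Rightarrow> real" where
  "pull_back J w k = w (Suc k) + (w k - w (Suc k)) / real (J + 1)"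

text \<open>The product is reordered by the origin of the particles: \<open>J\<close> new ones enter
  site 1, and site \<open>k\<close> sends all but the staying one to \<open>k + 1\<close>. By
  independence \<open>weighted_power_bernoulli\<close> then acts site by site.\<close>

lemma static_product_step:
  assumes s: "pep_state J t \<eta>" and w: "\<And>k. w k > 0"
  shows "measure_pmf.expectation (bern_vec (static_rate J \<eta>) (Suc t)) (\<lambda>B. \<Prod>k=1..Suc t. w k ^ PEP_update J \<eta> B k)
    \<le> w 1 ^ J * (\<Prod>k=1..t. pull_back J w k ^ \<eta> k)"
proof -
  interpret pep_dual J "static_rate J" static_factor by (rule pep_static)
  define f where "f k b = w (Suc k) ^ (\<eta> k - of_bool b) * w k ^ of_bool b" for k b
  let ?p = "static_rate J \<eta>"
  have ok: "rate_ok J \<eta> ?p" by (rule rate[OF s])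
  have z: "?p k = 0" if "k > t" for k using s that by (auto simp: pep_state_def static_rate_def)
  have "measure_pmf.expectation (bern_vec ?p (Suc t)) (\<lambda>B. \<Prod>k=1..Suc t. w k ^ PEP_update J \<eta> B k)
    = measure_pmf.expectation (bern_vec ?p (Suc t)) (\<lambda>B. w 1 ^ J * (\<Prod>k=1..t. f k (B k)))"
  proof (rule integral_cong_AE)
    show "AE B in measure_pmf (bern_vec ?p (Suc t)).
        (\<Prod>k=1..Suc t. w k ^ PEP_update J \<eta> B k) = w 1 ^ J * (\<Prod>k=1..t. f k (B k))"
      unfolding AE_measure_pmf_iff
    proof
      fix B assume B: "B \<in> set_pmf (bern_vec ?p (Suc t))"
      note adm = admissible_support[OF s ok B]
      \<comment> \<open>Site \<open>Suc t\<close> is empty before the step, so the product over stay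
        variables may stop at \<open>t\<close>.\<close>
      have last: "\<not> B (Suc t)" using adm(2)[of "Suc t"] by auto
      have shift: "(\<Prod>k=1..Suc t. g k) = g 1 * (\<Prod>k=1..t. g (Suc k))" for g :: "nat \<Rightarrow> real"
        by (simp add: prod.atLeast_Suc_atMost prod.shift_bounds_cl_Suc_ivl del: prod.cl_ivl_Suc)
      have "(\<Prod>k=1..Suc t. w k ^ PEP_update J \<eta> B k) =
        w 1 ^ J * (w 1 ^ of_bool (B 1) * (\<Prod>k=1..t. w (Suc k) ^ of_bool (B (Suc k)))) * (\<Prod>k=1..t. w (Suc k) ^ (\<eta> k - of_bool (B k)))"
      proof -
        have "PEP_update J \<eta> B 1 = J + of_bool (B 1)" using PEP_update_Suc[OF adm(1), of 0] by simp
        moreover have "(\<Prod>k=1..t. w (Suc k) ^ PEP_update J \<eta> B (Suc k)) =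
          (\<Prod>k=1..t. w (Suc k) ^ of_bool (B (Suc k))) * (\<Prod>k=1..t. w (Suc k) ^ (\<eta> k - of_bool (B k)))"
          unfolding prod.distrib[symmetric]
          by (intro prod.cong refl) (simp add: PEP_update_Suc[OF adm(1)] power_add)
        ultimately show ?thesis unfolding shift by (simp only: power_add mult_ac)
      qed
      also have "w 1 ^ of_bool (B 1) * (\<Prod>k=1..t. w (Suc k) ^ of_bool (B (Suc k))) = (\<Prod>k=1..Suc t. w k ^ of_bool (B k))"
        unfolding shift ..
      also have "\<dots> = (\<Prod>k=1..t. w k ^ of_bool (B k))" using last by simp
      finally show "(\<Prod>k=1..Suc t. w k ^ PEP_update J \<eta> B k) = w 1 ^ J * (\<Prod>k=1..t. f k (B k))"
        by (simp add: f_def prod.distrib mult_ac)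
    qed
  qed simp_all
  also have "\<dots> = w 1 ^ J * (\<Prod>k=1..t. ?p k * f k True + (1 - ?p k) * f k False)"
  proof -
    have "measure_pmf.expectation (bern_vec ?p (Suc t)) (\<lambda>B. \<Prod>k=1..t. f k (B k)) =
      (\<Prod>k=1..t. ?p k * f k True + (1 - ?p k) * f k False)"
      using ok z by (intro expectation_bern_vec_prod_nat) (auto simp: rate_ok_def)
    then show ?thesis by simp
  qed
  also have "\<dots> \<le> w 1 ^ J * (\<Prod>k=1..t. pull_back J w k ^ \<eta> k)"
  proof (intro mult_left_mono prod_mono conjI)
    fix k assume k: "k \<in> {1..t}"
    have f: "f k b \<ge> 0" for b using w by (simp add: f_def less_imp_le)
    show "0 \<le> ?p k * f k True + (1 - ?p k) * f k False"
      using ok k f by (intro add_nonneg_nonneg mult_nonneg_nonneg) (auto simp: rate_ok_def)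
    show "?p k * f k True + (1 - ?p k) * f k False \<le> pull_back J w k ^ \<eta> k"
      using weighted_power_bernoulli[OF w[of k] w[of "Suc k"], of "real (J + 1)" "\<eta> k"]
      by (simp add: f_def static_rate_def pull_back_def)
  qed (use w in \<open>simp add: less_imp_le\<close>)
  finally show ?thesis .
qed

text \<open>The linear counterpart of \<open>static_product_step\<close>, now with equality and with
  the same \<open>pull_back\<close>; this match closes the induction in
  \<open>static_poisson_bound\<close>.\<close>

lemma static_sum_step:
  assumes s: "pep_state J t \<eta>"
  shows "measure_pmf.expectation (bern_vec (static_rate J \<eta>) (Suc t)) (\<lambda>B. \<Sum>k=1..Suc t. w k * real (PEP_update J \<eta> B k))
    = real J * w 1 + (\<Sum>k=1..t. pull_back J w k * real (\<eta> k))"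
proof -
  interpret pep_dual J "static_rate J" static_factor by (rule pep_static)
  let ?p = "static_rate J \<eta>"
  have ok: "rate_ok J \<eta> ?p" by (rule rate[OF s])
  have z: "?p k = 0" if "k > t" for k using s that by (auto simp: pep_state_def static_rate_def)
  have I: "integrable (bern_vec ?p (Suc t)) g" for g :: "(nat \<Rightarrow> bool) \<Rightarrow> real"
    by (rule integrable_measure_pmf_finite[OF finite_bern_vec])
  have "measure_pmf.expectation (bern_vec ?p (Suc t)) (\<lambda>B. \<Sum>k=1..Suc t. w k * real (PEP_update J \<eta> B k))
    = measure_pmf.expectation (bern_vec ?p (Suc t))
        (\<lambda>B. real J * w 1 + (\<Sum>k=1..t. w (Suc k) * real (\<eta> k) + (w k - w (Suc k)) * of_bool (B k)))"
  proof (rule integral_cong_AE)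
    show "AE B in measure_pmf (bern_vec ?p (Suc t)). (\<Sum>k=1..Suc t. w k * real (PEP_update J \<eta> B k))
        = real J * w 1 + (\<Sum>k=1..t. w (Suc k) * real (\<eta> k) + (w k - w (Suc k)) * of_bool (B k))"
      unfolding AE_measure_pmf_iff
    proof
      fix B assume B: "B \<in> set_pmf (bern_vec ?p (Suc t))"
      note adm = admissible_support[OF s ok B]
      have last: "\<not> B (Suc t)" using adm(2)[of "Suc t"] by auto
      have shift: "(\<Sum>k=1..Suc t. g k) = g 1 + (\<Sum>k=1..t. g (Suc k))" for g :: "nat \<Rightarrow> real"
        by (simp add: sum.atLeast_Suc_atMost sum.shift_bounds_cl_Suc_ivl del: sum.cl_ivl_Suc)
      have occ: "real (\<eta> k - of_bool (B k)) = real (\<eta> k) - of_bool (B k)" if "k \<ge> 1" for k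
      proof -
        have "B k \<Longrightarrow> \<eta> k \<ge> 1" using adm(1) that by (auto simp: admissible_def Suc_le_eq)
        then show ?thesis by (auto simp: of_nat_diff)
      qed
      have "(\<Sum>k=1..Suc t. w k * real (PEP_update J \<eta> B k)) =
        real J * w 1 + (w 1 * of_bool (B 1) + (\<Sum>k=1..t. w (Suc k) * of_bool (B (Suc k))))
          + (\<Sum>k=1..t. w (Suc k) * real (\<eta> k - of_bool (B k)))"
      proof -
        have "real (PEP_update J \<eta> B 1) = real J + of_bool (B 1)" using PEP_update_Suc[OF adm(1), of 0] by simp
        moreover have "(\<Sum>k=1..t. w (Suc k) * real (PEP_update J \<eta> B (Suc k))) =
          (\<Sum>k=1..t. w (Suc k) * of_bool (B (Suc k))) + (\<Sum>k=1..t. w (Suc k) * real (\<eta> k - of_bool (B k)))"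
          unfolding sum.distrib[symmetric]
          by (intro sum.cong refl) (simp add: PEP_update_Suc[OF adm(1)] distrib_left)
        ultimately show ?thesis unfolding shift by (simp only: distrib_left mult.commute add_ac)
      qed
      also have "w 1 * of_bool (B 1) + (\<Sum>k=1..t. w (Suc k) * of_bool (B (Suc k))) = (\<Sum>k=1..Suc t. w k * of_bool (B k))"
        unfolding shift ..
      also have "\<dots> = (\<Sum>k=1..t. w k * of_bool (B k))" using last by simp
      also have "(\<Sum>k=1..t. w (Suc k) * real (\<eta> k - of_bool (B k))) = (\<Sum>k=1..t. w (Suc k) * (real (\<eta> k) - of_bool (B k)))"
        by (intro sum.cong refl) (simp add: occ)
      finally show "(\<Sum>k=1..Suc t. w k * real (PEP_update J \<eta> B k))
        = real J * w 1 + (\<Sum>k=1..t. w (Suc k) * real (\<eta> k) + (w k - w (Suc k)) * of_bool (B k))"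
        by (simp add: sum.distrib sum_subtractf algebra_simps)
    qed
  qed simp_all
  also have "\<dots> = real J * w 1 + (\<Sum>k=1..t. w (Suc k) * real (\<eta> k) +
      (w k - w (Suc k)) * measure_pmf.expectation (bern_vec ?p (Suc t)) (\<lambda>B. of_bool (B k)))"
    by (subst Bochner_Integration.integral_add Bochner_Integration.integral_sum; (intro I)?)+ (simp add: I)
  also have "\<dots> = real J * w 1 + (\<Sum>k=1..t. pull_back J w k * real (\<eta> k))"
  proof -
    have "measure_pmf.expectation (bern_vec ?p (Suc t)) (\<lambda>B. of_bool (B k)) = real (\<eta> k) / real (J + 1)" if "k \<ge> 1" for k
      using expectation_bern_vec_prod_nat[of "Suc t" ?p "{k}" "\<lambda>_. of_bool"] ok z that
      by (auto simp: rate_ok_def static_rate_def)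
    then have "(\<Sum>k=1..t. w (Suc k) * real (\<eta> k) +
      (w k - w (Suc k)) * measure_pmf.expectation (bern_vec ?p (Suc t)) (\<lambda>B. of_bool (B k)))
      = (\<Sum>k=1..t. pull_back J w k * real (\<eta> k))"
      by (intro sum.cong refl) (simp add: pull_back_def distrib_right)
    then show ?thesis by simp
  qed
  finally show ?thesis .
qed

text \<open>The right side is the generating functional of independent Poisson occupation numbers
  with the same means. The entering particles cost \<open>(1 + w 1) ^ J \<le> exp (J * w 1)\<close>,
  and the rest is transported by \<open>pull_back\<close> on both sides. As an average,
  \<open>pull_back\<close> preserves \<open>w > -1\<close>.\<close>

lemma static_poisson_bound:
  assumes "\<And>k. w k > -1"
  shows "measure_pmf.expectation (pep_chain J (static_rate J) t) (\<lambda>\<eta>. \<Prod>k=1..t. (1 + w k) ^ \<eta> k)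
    \<le> exp (measure_pmf.expectation (pep_chain J (static_rate J) t) (\<lambda>\<eta>. \<Sum>k=1..t. w k * real (\<eta> k)))"
  using assms
proof (induction t arbitrary: w)
  case 0
  then show ?case by simp
next
  case (Suc t)
  interpret pep_dual J "static_rate J" static_factor by (rule pep_static)
  let ?E = "\<lambda>t. measure_pmf.expectation (pep_chain J (static_rate J) t)"
  let ?v = "pull_back J w"
  have v: "?v k > -1" for k
  proof -
    have "real J * w (Suc k) + w k > real J * (-1) + (-1)"
      using Suc.prems[of "Suc k"] Suc.prems[of k] by (intro add_le_less_mono mult_left_mono) auto
    then show ?thesis by (simp add: pull_back_def field_simps)
  qed
  have p1: "pull_back J (\<lambda>k. 1 + w k) k = 1 + ?v k" for k by (simp add: pull_back_def)
  have w1: "1 + w 1 \<ge> 0" "1 + w 1 \<le> exp (w 1)"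
    using Suc.prems[of 1] exp_ge_add_one_self[of "w 1"] by auto
  have "?E (Suc t) (\<lambda>\<eta>. \<Prod>k=1..Suc t. (1 + w k) ^ \<eta> k) =
    ?E t (\<lambda>\<eta>. measure_pmf.expectation (bern_vec (static_rate J \<eta>) (Suc t)) (\<lambda>B. \<Prod>k=1..Suc t. (1 + w k) ^ PEP_update J \<eta> B k))"
    by (rule chain_step) simp
  also have "\<dots> \<le> ?E t (\<lambda>\<eta>. (1 + w 1) ^ J * (\<Prod>k=1..t. (1 + ?v k) ^ \<eta> k))"
  proof (rule chain_mono)
    fix \<eta> assume s: "pep_state J t \<eta>"
    have "1 + w k > 0" for k using Suc.prems[of k] by simp
    from static_product_step[OF s, of "\<lambda>k. 1 + w k", OF this]
    show "measure_pmf.expectation (bern_vec (static_rate J \<eta>) (Suc t)) (\<lambda>B. \<Prod>k=1..Suc t. (1 + w k) ^ PEP_update J \<eta> B k)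
      \<le> (1 + w 1) ^ J * (\<Prod>k=1..t. (1 + ?v k) ^ \<eta> k)" unfolding p1 .
  qed
  also have "\<dots> = (1 + w 1) ^ J * ?E t (\<lambda>\<eta>. \<Prod>k=1..t. (1 + ?v k) ^ \<eta> k)" by simp
  also have "\<dots> \<le> exp (w 1) ^ J * exp (?E t (\<lambda>\<eta>. \<Sum>k=1..t. ?v k * real (\<eta> k)))"
  proof (rule mult_mono)
    show "(1 + w 1) ^ J \<le> exp (w 1) ^ J" using w1 by (intro power_mono)
    show "?E t (\<lambda>\<eta>. \<Prod>k=1..t. (1 + ?v k) ^ \<eta> k) \<le> exp (?E t (\<lambda>\<eta>. \<Sum>k=1..t. ?v k * real (\<eta> k)))"
      by (rule Suc.IH) (rule v)
    show "0 \<le> ?E t (\<lambda>\<eta>. \<Prod>k=1..t. (1 + ?v k) ^ \<eta> k)"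
    proof -
      have "1 + ?v k \<ge> 0" for k using v[of k] by simp
      then show ?thesis by (intro Bochner_Integration.integral_nonneg prod_nonneg zero_le_power) auto
    qed
  qed simp
  also have "\<dots> = exp (real J * w 1 + ?E t (\<lambda>\<eta>. \<Sum>k=1..t. ?v k * real (\<eta> k)))"
    by (simp add: exp_add exp_of_nat_mult)
  also have "real J * w 1 + ?E t (\<lambda>\<eta>. \<Sum>k=1..t. ?v k * real (\<eta> k)) = ?E t (\<lambda>\<eta>. real J * w 1 + (\<Sum>k=1..t. ?v k * real (\<eta> k)))"
    by (subst Bochner_Integration.integral_add) auto
  also have "\<dots> = ?E (Suc t) (\<lambda>\<eta>. \<Sum>k=1..Suc t. w k * real (\<eta> k))"
    by (rule chain_step[OF static_sum_step, symmetric])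
  finally show ?case .
qed

text \<open>The weight \<open>exp b - 1\<close> on the sites from \<open>x\<close> on exceeds -1 for
  negative \<open>b\<close> as well, so both tails are covered.\<close>

lemma static_exp_moment:
  assumes x: "x \<ge> 1"
  shows "measure_pmf.expectation (pep_chain J (static_rate J) t) (\<lambda>\<eta>. exp (b * height J t \<eta> x))
    \<le> exp ((exp b - 1) * measure_pmf.expectation (pep_chain J (static_rate J) t) (\<lambda>\<eta>. height J t \<eta> x))"
proof -
  define w where "w k = (if nat x \<le> k then exp b - 1 else 0)" for k
  have "{k\<in>{1..t}. nat x \<le> k} = {nat x..t}" using x by auto
  then have sel: "(\<Sum>k=1..t. if nat x \<le> k then f k else 0) = (\<Sum>k\<in>{nat x..t}. f k)" for f :: "nat \<Rightarrow> real"
    by (simp add: sum.inter_filter[symmetric])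
  have s: "(\<Sum>k=1..t. w k * real (\<eta> k)) = (exp b - 1) * height J t \<eta> x" for \<eta>
    unfolding height_eq_nat_sum[OF x] sum_distrib_left sel[symmetric] by (intro sum.cong) (auto simp: w_def)
  have e: "exp (b * height J t \<eta> x) = (\<Prod>k=1..t. (1 + w k) ^ \<eta> k)" for \<eta>
  proof -
    have "b * height J t \<eta> x = (\<Sum>k=1..t. real (\<eta> k) * (if nat x \<le> k then b else 0))"
      unfolding height_eq_nat_sum[OF x] sum_distrib_left sel[symmetric] by (intro sum.cong) auto
    then have "exp (b * height J t \<eta> x) = (\<Prod>k=1..t. exp (real (\<eta> k) * (if nat x \<le> k then b else 0)))"
      by (simp add: exp_sum)
    also have "\<dots> = (\<Prod>k=1..t. (1 + w k) ^ \<eta> k)"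
      unfolding exp_of_nat_mult by (intro prod.cong) (auto simp: w_def)
    finally show ?thesis .
  qed
  have "w k > -1" for k by (simp add: w_def)
  from static_poisson_bound[of w J t, OF this] show ?thesis unfolding e[symmetric] s by simp
qed

text \<open>Take exponents \<open>v\<close> equal to plus or minus \<open>1 / sqrt \<mu>\<close>.
  Then \<open>exp v - 1 - v \<le> v^2\<close> bounds the centred exponent by
  \<open>v^2 * \<mu> = 1\<close>, so each sign contributes \<open>exp 1\<close>. The assumption
  \<open>\<mu> \<ge> 1\<close> keeps \<open>\<bar>v\<bar> \<le> 1\<close>.\<close>

lemma static_deviation:
  fixes J t x
  defines "E \<equiv> measure_pmf.expectation (pep_chain J (static_rate J) t)"
  defines "\<mu> \<equiv> E (\<lambda>\<eta>. height J t \<eta> x)"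
  assumes x: "x \<ge> 1" and \<mu>: "\<mu> \<ge> 1"
  shows "E (\<lambda>\<eta>. exp \<bar>(height J t \<eta> x - \<mu>) / sqrt \<mu>\<bar>) \<le> 2 * exp 1"
proof -
  interpret pep_dual J "static_rate J" static_factor by (rule pep_static)
  have quad: "exp v \<le> 1 + v + v\<^sup>2" if "\<bar>v\<bar> \<le> 1" for v :: real
  proof (cases "v \<ge> 0")
    case True
    then show ?thesis using that exp_bound[of v] by simp
  next
    case False
    define u where "u = - v"
    have u: "0 \<le> u" "u \<le> 1" using False that by (auto simp: u_def)
    \<comment> \<open>The product equals \<open>1 + u^3\<close>.\<close>
    have "1 \<le> (1 - u + u\<^sup>2) * (1 + u)" using u by (simp add: power2_eq_square algebra_simps)
    also have "\<dots> \<le> (1 - u + u\<^sup>2) * exp u" using u by (intro mult_left_mono) auto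
    finally have "exp (-u) \<le> 1 - u + u\<^sup>2" by (simp add: exp_minus field_simps)
    then show ?thesis by (simp add: u_def)
  qed
  have side: "E (\<lambda>\<eta>. exp (\<sigma> * ((height J t \<eta> x - \<mu>) / sqrt \<mu>))) \<le> exp 1" if "\<bar>\<sigma>\<bar> = 1" for \<sigma> :: real
  proof -
    define v where "v = \<sigma> / sqrt \<mu>"
    have v: "\<bar>v\<bar> \<le> 1" "v\<^sup>2 = 1 / \<mu>"
    proof -
      have "\<sigma>\<^sup>2 = 1" using that by (metis one_power2 power2_abs)
      then show "v\<^sup>2 = 1 / \<mu>" using \<mu> by (simp add: v_def power_divide)
      show "\<bar>v\<bar> \<le> 1" using that \<mu> by (simp add: v_def abs_divide)
    qed
    have "E (\<lambda>\<eta>. exp (\<sigma> * ((height J t \<eta> x - \<mu>) / sqrt \<mu>))) = E (\<lambda>\<eta>. exp (- v * \<mu>) * exp (v * height J t \<eta> x))"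
      unfolding v_def exp_add[symmetric] by (simp add: diff_divide_distrib algebra_simps)
    also have "\<dots> = exp (- v * \<mu>) * E (\<lambda>\<eta>. exp (v * height J t \<eta> x))" by (simp add: E_def)
    also have "\<dots> \<le> exp (- v * \<mu>) * exp ((exp v - 1) * \<mu>)"
      unfolding \<mu>_def E_def by (intro mult_left_mono static_exp_moment x) auto
    also have "\<dots> = exp ((exp v - 1 - v) * \<mu>)" by (simp add: exp_add[symmetric] algebra_simps)
    also have "\<dots> \<le> exp (v\<^sup>2 * \<mu>)" using quad[OF v(1)] \<mu> by (simp add: mult_right_mono)
    also have "\<dots> = exp 1" using v(2) \<mu> by simp
    finally show ?thesis .
  qed
  have "E (\<lambda>\<eta>. exp \<bar>(height J t \<eta> x - \<mu>) / sqrt \<mu>\<bar>) \<le>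
    E (\<lambda>\<eta>. exp (1 * ((height J t \<eta> x - \<mu>) / sqrt \<mu>)) + exp (-1 * ((height J t \<eta> x - \<mu>) / sqrt \<mu>)))"
  proof -
    have "exp \<bar>z\<bar> \<le> exp (1 * z) + exp (-1 * z)" for z :: real
      by (cases "z \<ge> 0") (auto simp: add_increasing add_increasing2)
    then show ?thesis unfolding E_def by (intro chain_mono)
  qed
  also have "\<dots> = E (\<lambda>\<eta>. exp (1 * ((height J t \<eta> x - \<mu>) / sqrt \<mu>))) + E (\<lambda>\<eta>. exp (-1 * ((height J t \<eta> x - \<mu>) / sqrt \<mu>)))"
    unfolding E_def by (rule Bochner_Integration.integral_add) auto
  also have "\<dots> \<le> exp 1 + exp 1" by (intro add_mono side) auto
  finally show ?thesis by simp
qed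

text \<open>In the expansion of the product minus 1 every monomial carries at least one
  \<open>\<delta>\<close>, and higher powers of \<open>\<delta>\<close> are at most
  \<open>\<delta>\<close>.\<close>

lemma prod_one_plus_diff:
  fixes v :: "'a \<Rightarrow> real"
  assumes "finite I" "0 \<le> \<delta>" "\<delta> \<le> 1"
  shows "\<bar>(\<Prod>i\<in>I. 1 + \<delta> * v i) - 1\<bar> \<le> \<delta> * ((\<Prod>i\<in>I. 1 + \<bar>v i\<bar>) - 1)"
  using assms(1)
proof induction
  case (insert j I)
  define a b where "a = (\<Prod>i\<in>I. 1 + \<delta> * v i)" and "b = (\<Prod>i\<in>I. 1 + \<bar>v i\<bar>)"
  have "\<bar>a\<bar> \<le> b" unfolding a_def b_def abs_prod
  proof (intro prod_mono conjI)
    fix i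
    have "\<bar>1 + \<delta> * v i\<bar> \<le> 1 + \<delta> * \<bar>v i\<bar>" using assms by (simp add: abs_mult order_trans[OF abs_triangle_ineq])
    also have "\<dots> \<le> 1 + \<bar>v i\<bar>" using assms by (simp add: mult_left_le_one_le)
    finally show "\<bar>1 + \<delta> * v i\<bar> \<le> 1 + \<bar>v i\<bar>" .
  qed simp
  have IH: "\<bar>a - 1\<bar> \<le> \<delta> * (b - 1)" using insert.IH by (simp add: a_def b_def)
  have "\<bar>(1 + \<delta> * v j) * a - 1\<bar> \<le> \<bar>a - 1\<bar> + \<delta> * (\<bar>v j\<bar> * \<bar>a\<bar>)"
    using assms abs_triangle_ineq[of "a - 1" "\<delta> * v j * a"] by (simp add: abs_mult algebra_simps)
  also have "\<dots> \<le> \<delta> * (b - 1) + \<delta> * (\<bar>v j\<bar> * b)"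
    using IH \<open>\<bar>a\<bar> \<le> b\<close> assms by (intro add_mono mult_left_mono) auto
  also have "\<dots> = \<delta> * ((1 + \<bar>v j\<bar>) * b - 1)" by (simp add: algebra_simps)
  finally show ?case using insert.hyps by (simp add: a_def b_def)
qed simp

lemma power_le_exp:
  fixes y :: real
  assumes "y \<ge> 0"
  shows "y ^ m \<le> real m ^ m * exp y"
proof (cases "m = 0")
  case False
  have "y / real m \<le> exp (y / real m)" using exp_ge_add_one_self[of "y / real m"] by linarith
  then have "(y / real m) ^ m \<le> exp (y / real m) ^ m" using assms by (intro power_mono) auto
  also have "\<dots> = exp y" using False by (simp add: exp_of_nat_mult[symmetric])
  finally show ?thesis using False by (simp add: power_divide field_simps)
qed (use assms in simp)

text \<open>In units of \<open>\<mu>\<close> each factor is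
  \<open>1 + \<delta> * (W - i * \<delta>)\<close>, with \<open>W\<close> the fluctuation in units
  of \<open>sqrt \<mu>\<close>. The relative error is thus \<open>\<delta>\<close> times a
  polynomial in \<open>\<bar>W\<bar>\<close>, which the exponential moment of
  \<open>static_deviation\<close> absorbs.\<close>

lemma static_falling_moment:
  fixes J t x m
  defines "E \<equiv> measure_pmf.expectation (pep_chain J (static_rate J) t)"
  defines "\<mu> \<equiv> E (\<lambda>\<eta>. height J t \<eta> x)"
  assumes x: "x \<ge> 1" and \<mu>: "\<mu> \<ge> 1"
  shows "\<bar>E (\<lambda>\<eta>. \<Prod>i<m. height J t \<eta> x - real i) / \<mu> ^ m - 1\<bar> \<le> real m ^ m * exp (real m + 2) * 2 / sqrt \<mu>"
proof -
  interpret pep_dual J "static_rate J" static_factor by (rule pep_static)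
  define W where "W \<eta> = (height J t \<eta> x - \<mu>) / sqrt \<mu>" for \<eta>
  define \<delta> where "\<delta> = 1 / sqrt \<mu>"
  \<comment> \<open>This comes from \<open>power_le_exp\<close> at
    \<open>m + 1 + \<bar>W\<bar>\<close>; the remaining factor \<open>2 * exp 1\<close> is the bound
    of \<open>static_deviation\<close>.\<close>
  define C where "C = real m ^ m * exp (real m + 1)"
  have \<delta>: "0 \<le> \<delta>" "\<delta> \<le> 1" using \<mu> by (auto simp: \<delta>_def)
  have sq: "sqrt \<mu> * sqrt \<mu> = \<mu>" "sqrt \<mu> > 0" using \<mu> by auto
  have pt: "\<bar>(\<Prod>i<m. height J t \<eta> x - real i) / \<mu> ^ m - 1\<bar> \<le> \<delta> * C * exp \<bar>W \<eta>\<bar>" for \<eta>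
  proof -
    have f: "(height J t \<eta> x - real i) / \<mu> = 1 + \<delta> * (W \<eta> - real i * \<delta>)" for i
    proof -
      have "\<delta> * W \<eta> = (height J t \<eta> x - \<mu>) / \<mu>" "\<delta> * (real i * \<delta>) = real i / \<mu>"
        using sq by (simp_all add: \<delta>_def W_def divide_divide_eq_left)
      then show ?thesis using \<mu> by (simp add: right_diff_distrib diff_divide_distrib)
    qed
    have "(\<Prod>i<m. height J t \<eta> x - real i) / \<mu> ^ m = (\<Prod>i<m. (height J t \<eta> x - real i) / \<mu>)"
      by (simp add: prod_dividef)
    then have "\<bar>(\<Prod>i<m. height J t \<eta> x - real i) / \<mu> ^ m - 1\<bar> \<le> \<delta> * ((\<Prod>i<m. 1 + \<bar>W \<eta> - real i * \<delta>\<bar>) - 1)"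
      unfolding f using prod_one_plus_diff[of "{..<m}" \<delta> "\<lambda>i. W \<eta> - real i * \<delta>"] \<delta> by simp
    also have "\<dots> \<le> \<delta> * (\<Prod>i<m. 1 + \<bar>W \<eta> - real i * \<delta>\<bar>)" using \<delta> by (intro mult_left_mono) auto
    also have "\<dots> \<le> \<delta> * (\<Prod>i<m. real m + 1 + \<bar>W \<eta>\<bar>)"
    proof (intro mult_left_mono prod_mono conjI \<delta>)
      fix i assume "i \<in> {..<m}"
      then have "real i * \<delta> \<le> real m * 1" using \<delta> by (intro mult_mono) auto
      moreover have "real i * \<delta> \<ge> 0" using \<delta> by simp
      ultimately show "1 + \<bar>W \<eta> - real i * \<delta>\<bar> \<le> real m + 1 + \<bar>W \<eta>\<bar>" by linarith
    qed simp
    also have "\<dots> \<le> \<delta> * (C * exp \<bar>W \<eta>\<bar>)"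
      using power_le_exp[of "real m + 1 + \<bar>W \<eta>\<bar>" m] \<delta> by (intro mult_left_mono) (simp_all add: C_def exp_add)
    finally show ?thesis by (simp add: mult.assoc)
  qed
  have "E (\<lambda>\<eta>. \<Prod>i<m. height J t \<eta> x - real i) / \<mu> ^ m - 1 = E (\<lambda>\<eta>. (\<Prod>i<m. height J t \<eta> x - real i) / \<mu> ^ m - 1)"
    unfolding E_def by (subst Bochner_Integration.integral_diff) auto
  also have "\<bar>\<dots>\<bar> \<le> E (\<lambda>\<eta>. \<bar>(\<Prod>i<m. height J t \<eta> x - real i) / \<mu> ^ m - 1\<bar>)"
    unfolding E_def by (rule integral_abs_bound)
  also have "\<dots> \<le> E (\<lambda>\<eta>. \<delta> * C * exp \<bar>W \<eta>\<bar>)" unfolding E_def by (intro chain_mono pt)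
  also have "\<dots> = \<delta> * C * E (\<lambda>\<eta>. exp \<bar>W \<eta>\<bar>)" by (simp add: E_def)
  also have "\<dots> \<le> \<delta> * C * (2 * exp 1)"
    unfolding W_def \<mu>_def E_def
    using static_deviation[of x J t] x \<mu> \<delta> by (intro mult_left_mono) (auto simp: C_def \<mu>_def E_def)
  also have "\<dots> = real m ^ m * exp (real m + 2) * 2 / sqrt \<mu>"
    using exp_add[of "real m + 1" 1] by (simp add: C_def \<delta>_def add.assoc)
  finally show ?thesis .
qed


subsection \<open>Scaling limit\<close>

text \<open>The positive part of a centred variable has half the mean of its absolute value. The
  positive part is also 1-Lipschitz, so displacing its argument changes the mean by at most the
  displacement.\<close>

lemma static_mean_approx:
  fixes J t x
  defines "p \<equiv> real J / real (J + 1)"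
  shows "\<bar>measure_pmf.expectation (pep_chain J (static_rate J) t) (\<lambda>\<eta>. height J t \<eta> x)
      - real (J + 1) / 2 * measure_pmf.expectation (binomial_pmf t p) (\<lambda>k. \<bar>real k - real t * p\<bar>)\<bar>
    \<le> real (J + 1) * \<bar>1 - of_int x + real t * p\<bar>"
proof -
  let ?E = "measure_pmf.expectation (binomial_pmf t p)"
  have p: "p \<in> {0..1}" by (simp add: p_def)
  have I: "integrable (binomial_pmf t p) f" for f :: "nat \<Rightarrow> real" using p by auto
  define d where "d = 1 - of_int x + real t * p"
  have half: "?E (\<lambda>k. max 0 (real k - real t * p)) = ?E (\<lambda>k. \<bar>real k - real t * p\<bar>) / 2"
  proof -
    have "?E (\<lambda>k. max 0 (real k - real t * p)) = ?E (\<lambda>k. \<bar>real k - real t * p\<bar> / 2 + (real k - real t * p) / 2)"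
      by (intro Bochner_Integration.integral_cong refl) (auto simp: max_def field_simps)
    also have "\<dots> = ?E (\<lambda>k. \<bar>real k - real t * p\<bar> / 2) + ?E (\<lambda>k. (real k - real t * p) / 2)"
      by (rule Bochner_Integration.integral_add) (rule I)+
    also have "?E (\<lambda>k. (real k - real t * p) / 2) = ?E (\<lambda>k. real k - real t * p) / 2" by (rule integral_divide_zero)
    finally show ?thesis unfolding binomial_central_moments(1)[OF p] by simp
  qed
  have "?E (\<lambda>k. max 0 (1 - of_int x + real k)) - ?E (\<lambda>k. max 0 (real k - real t * p))
    = ?E (\<lambda>k. max 0 (1 - of_int x + real k) - max 0 (real k - real t * p))"
    by (rule Bochner_Integration.integral_diff[symmetric]) (rule I)+
  also have "\<bar>\<dots>\<bar> \<le> ?E (\<lambda>k. \<bar>max 0 (1 - of_int x + real k) - max 0 (real k - real t * p)\<bar>)"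
    by (rule integral_abs_bound)
  also have "\<dots> \<le> ?E (\<lambda>k. \<bar>d\<bar>)"
    by (intro integral_mono I) (auto simp: d_def)
  finally have "\<bar>?E (\<lambda>k. max 0 (1 - of_int x + real k)) - ?E (\<lambda>k. \<bar>real k - real t * p\<bar>) / 2\<bar> \<le> \<bar>d\<bar>"
    unfolding half by simp
  then have "real (J + 1) * \<bar>?E (\<lambda>k. max 0 (1 - of_int x + real k)) - ?E (\<lambda>k. \<bar>real k - real t * p\<bar>) / 2\<bar> \<le> real (J + 1) * \<bar>d\<bar>"
    by (intro mult_left_mono) auto
  moreover have "\<bar>real (J + 1) * A - real (J + 1) / 2 * B\<bar> = real (J + 1) * \<bar>A - B / 2\<bar>" for A B :: real
  proof -
    have "real (J + 1) * A - real (J + 1) / 2 * B = real (J + 1) * (A - B / 2)" by (simp add: right_diff_distrib)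
    then show ?thesis by (simp only: abs_mult abs_of_nat)
  qed
  ultimately show ?thesis unfolding static_mean d_def p_def[symmetric] by simp
qed

section \<open>Observation time and site, and the limit of the static moments\<close>

definition obs_time :: "real \<Rightarrow> real \<Rightarrow> nat" where
  "obs_time r T = nat \<lfloor>r * T\<rfloor>"

definition obs_site :: "nat \<Rightarrow> real \<Rightarrow> real \<Rightarrow> real \<Rightarrow> int" where
  "obs_site J r s T = \<lfloor>real J * r * T / real (J + 1) + s * T powr (1/4)\<rfloor>"

text \<open>Up to the term in \<open>s\<close> this is \<open>holes - height\<close> at the observed
  point, which is deterministic. The speed \<open>J / (J + 1)\<close> cancels what is linear in
  \<open>T\<close>; the floor of the site together with the \<open>- 1\<close> costs at most
  \<open>2 * (J + 1)\<close>, the floor of the time at most \<open>J + 1\<close>. The same quantity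
  measures the displacement in \<open>static_mean_approx\<close>.\<close>

lemma obs_offset:
  assumes r: "r > 0" and T: "T \<ge> 0"
  shows "\<bar>real (J + 1) * (of_int (obs_site J r s T) - 1) - real J * real (obs_time r T) - s * real (J + 1) * T powr (1/4)\<bar>
    \<le> 3 * real (J + 1)"
proof -
  define X where "X = real J * r * T / real (J + 1) + s * T powr (1/4)"
  define u where "u = X - of_int (obs_site J r s T)"
  define v where "v = r * T - real (obs_time r T)"
  have u: "0 \<le> u" "u < 1" unfolding u_def obs_site_def X_def[symmetric] by linarith+
  have "r * T \<ge> 0" using r T by simp
  then have v: "0 \<le> v" "v < 1" unfolding v_def obs_time_def by (simp_all add: of_nat_nat) linarith+
  have KX: "real (J + 1) * X = real J * (r * T) + s * real (J + 1) * T powr (1/4)"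
    by (simp add: X_def field_simps)
  have "real (J + 1) * (of_int (obs_site J r s T) - 1) - real J * real (obs_time r T) - s * real (J + 1) * T powr (1/4)
     = real (J + 1) * (X - u - 1) - real J * (r * T - v) - s * real (J + 1) * T powr (1/4)"
    by (simp add: u_def v_def)
  also have "\<dots> = real J * v - real (J + 1) * (u + 1)"
    using KX by (simp add: algebra_simps)
  also have "\<bar>\<dots>\<bar> \<le> \<bar>real J * v\<bar> + \<bar>real (J + 1) * (u + 1)\<bar>" by (rule abs_triangle_ineq4)
  also have "\<bar>real J * v\<bar> \<le> real (J + 1) * 1" unfolding abs_mult using v by (intro mult_mono) auto
  also have "\<bar>real (J + 1) * (u + 1)\<bar> \<le> real (J + 1) * 2" unfolding abs_mult using u by (intro mult_mono) auto
  finally show ?thesis by simp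
qed

lemma obs_time_at_top: "r > 0 \<Longrightarrow> filterlim (obs_time r) sequentially at_top"
  unfolding obs_time_def
  by (intro filterlim_compose[OF filterlim_nat_sequentially] filterlim_compose[OF filterlim_floor_sequentially]
     filterlim_tendsto_pos_mult_at_top[OF tendsto_const] filterlim_ident)

lemma obs_time_ratio:
  assumes r: "r > 0"
  shows "((\<lambda>T. real (obs_time r T) / T) \<longlongrightarrow> r) at_top"
proof (rule tendsto_sandwich)
  show "\<forall>\<^sub>F T in at_top. r - 1 / T \<le> real (obs_time r T) / T"
    using eventually_gt_at_top[of 0]
  proof eventually_elim
    case (elim T)
    have "r * T - 1 \<le> real (obs_time r T)" unfolding obs_time_def by linarith
    then have "(r * T - 1) / T \<le> real (obs_time r T) / T" using elim by (intro divide_right_mono) auto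
    then show ?case using elim by (simp add: diff_divide_distrib)
  qed
  show "\<forall>\<^sub>F T in at_top. real (obs_time r T) / T \<le> r"
    using eventually_gt_at_top[of 0]
  proof eventually_elim
    case (elim T)
    have "real (obs_time r T) \<le> r * T" unfolding obs_time_def using elim r by (simp add: of_nat_nat)
    then show ?case using elim by (simp add: field_simps)
  qed
  show "((\<lambda>T. r - 1 / T) \<longlongrightarrow> r) at_top" by real_asymp
qed simp

lemma obs_site_at_top:
  assumes "J \<ge> 1" "r > 0"
  shows "\<forall>\<^sub>F T in at_top. obs_site J r s T \<ge> 1"
proof -
  define c where "c = real J * r / real (J + 1)"
  have c: "c > 0" using assms by (simp add: c_def)
  \<comment> \<open>Even for negative \<open>s\<close> the positive linear drift wins.\<close>
  have "filterlim (\<lambda>T. c * T + s * T powr (1/4)) at_top at_top" using c by real_asymp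
  then have "\<forall>\<^sub>F T in at_top. c * T + s * T powr (1/4) \<ge> 1" by (simp add: filterlim_at_top)
  then show ?thesis
  proof eventually_elim
    case (elim T)
    then show ?case unfolding obs_site_def c_def by (simp add: le_floor_iff algebra_simps)
  qed
qed

text \<open>The binomial deviation is of order \<open>sqrt T\<close>, while the offset of the
  observed site costs only \<open>O(T powr (1/4))\<close>, so \<open>s\<close> disappears. The
  constant comes from \<open>K * p = J\<close> and \<open>K * (1 - p) = 1\<close>.\<close>

lemma static_mean_limit:
  assumes J: "J \<ge> 1" and r: "r > 0"
  shows "((\<lambda>T. measure_pmf.expectation (pep_chain J (static_rate J) (obs_time r T))
      (\<lambda>\<eta>. height J (obs_time r T) \<eta> (obs_site J r s T)) / sqrt T) \<longlongrightarrow> sqrt (r * real J / (2 * pi))) at_top"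
proof -
  define p where "p = real J / real (J + 1)"
  define K where "K = real (J + 1)"
  have K: "K > 0" by (simp add: K_def)
  have p: "0 < p" "p < 1" using J by (auto simp: p_def)
  define \<mu> where "\<mu> T = measure_pmf.expectation (pep_chain J (static_rate J) (obs_time r T))
      (\<lambda>\<eta>. height J (obs_time r T) \<eta> (obs_site J r s T))" for T
  define D where "D n = measure_pmf.expectation (binomial_pmf n p) (\<lambda>k. \<bar>real k - real n * p\<bar>)" for n
  have "((\<lambda>T. D (obs_time r T) / sqrt (real (obs_time r T))) \<longlongrightarrow> sqrt (2 * p * (1 - p) / pi)) at_top"
    unfolding D_def by (rule filterlim_compose[OF binomial_abs_deviation[OF p] obs_time_at_top[OF r]])
  then have "((\<lambda>T. K / 2 * (D (obs_time r T) / sqrt (real (obs_time r T)) * sqrt (real (obs_time r T) / T))) \<longlongrightarrow>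
      K / 2 * (sqrt (2 * p * (1 - p) / pi) * sqrt r)) at_top"
    by (intro tendsto_intros obs_time_ratio r)
  moreover have "\<forall>\<^sub>F T in at_top. K / 2 * (D (obs_time r T) / sqrt (real (obs_time r T)) * sqrt (real (obs_time r T) / T))
      = K / 2 * D (obs_time r T) / sqrt T"
    using eventually_gt_at_top[of "2 / r"] eventually_gt_at_top[of 0]
  proof eventually_elim
    case (elim T)
    then have "r * T > 2" using r by (simp add: field_simps)
    then have "obs_time r T > 0" unfolding obs_time_def by linarith
    then show ?case using elim by (simp add: real_sqrt_divide)
  qed
  ultimately have "((\<lambda>T. K / 2 * D (obs_time r T) / sqrt T) \<longlongrightarrow>
      K / 2 * (sqrt (2 * p * (1 - p) / pi) * sqrt r)) at_top"
    by (rule Lim_transform_eventually)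
  moreover have "K / 2 * (sqrt (2 * p * (1 - p) / pi) * sqrt r) = sqrt (r * real J / (2 * pi))"
  proof -
    have "K / 2 * (sqrt (2 * p * (1 - p) / pi) * sqrt r) = sqrt ((K / 2)\<^sup>2) * (sqrt (2 * p * (1 - p) / pi) * sqrt r)"
      using K by simp
    also have "\<dots> = sqrt ((K / 2)\<^sup>2 * (2 * p * (1 - p) / pi * r))" by (simp only: real_sqrt_mult)
    also have "(K / 2)\<^sup>2 * (2 * p * (1 - p) / pi * r) = r * real J / (2 * pi)"
    proof -
      have "K * p = real J" "K * (1 - p) = 1" by (simp_all add: K_def p_def field_simps)
      have "(K / 2)\<^sup>2 * (2 * p * (1 - p) / pi * r) = (K * p) * (K * (1 - p)) * r / (2 * pi)"
        by (simp add: power2_eq_square field_simps)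
      then show ?thesis unfolding \<open>K * p = real J\<close> \<open>K * (1 - p) = 1\<close> by simp
    qed
    finally show ?thesis .
  qed
  ultimately have main: "((\<lambda>T. K / 2 * D (obs_time r T) / sqrt T) \<longlongrightarrow> sqrt (r * real J / (2 * pi))) at_top"
    by (simp only:)
  define c where "c = \<bar>s\<bar> * K"
  have "((\<lambda>T. \<mu> T / sqrt T - K / 2 * D (obs_time r T) / sqrt T) \<longlongrightarrow> 0) at_top"
  proof (rule Lim_null_comparison)
    show "((\<lambda>T. (3 * K + c * T powr (1/4)) / sqrt T) \<longlongrightarrow> 0) at_top" by real_asymp
    show "\<forall>\<^sub>F T in at_top. norm (\<mu> T / sqrt T - K / 2 * D (obs_time r T) / sqrt T) \<le> (3 * K + c * T powr (1/4)) / sqrt T"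
      using eventually_gt_at_top[of 0]
    proof eventually_elim
      case (elim T)
      have "\<bar>\<mu> T - K / 2 * D (obs_time r T)\<bar> \<le> K * \<bar>1 - of_int (obs_site J r s T) + real (obs_time r T) * p\<bar>"
        using static_mean_approx[of J "obs_time r T" "obs_site J r s T"] by (simp only: \<mu>_def D_def K_def p_def)
      also have "\<dots> = \<bar>K * (of_int (obs_site J r s T) - 1) - real J * real (obs_time r T)\<bar>"
      proof -
        have "K * (1 - of_int (obs_site J r s T) + real (obs_time r T) * p) = - (K * (of_int (obs_site J r s T) - 1) - real J * real (obs_time r T))"
          by (simp add: K_def p_def field_simps)
        then show ?thesis using K by (metis abs_minus_cancel abs_mult abs_of_pos)
      qed
      also have "\<dots> \<le> 3 * K + \<bar>s * K * T powr (1/4)\<bar>"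
        using obs_offset[OF r, of T J s] elim unfolding K_def by linarith
      also have "\<dots> = 3 * K + c * T powr (1/4)" using K by (simp add: c_def abs_mult)
      finally have "\<bar>\<mu> T - K / 2 * D (obs_time r T)\<bar> / sqrt T \<le> (3 * K + c * T powr (1/4)) / sqrt T"
        using elim by (intro divide_right_mono) auto
      moreover have "norm (\<mu> T / sqrt T - K / 2 * D (obs_time r T) / sqrt T) = \<bar>\<mu> T - K / 2 * D (obs_time r T)\<bar> / sqrt T"
        using elim unfolding real_norm_def diff_divide_distrib[symmetric] abs_divide by simp
      ultimately show ?case by simp
    qed
  qed
  from tendsto_add[OF this main] show ?thesis by (simp add: \<mu>_def)
qed

lemma static_falling_limit:
  assumes J: "J \<ge> 1" and r: "r > 0"
  shows "((\<lambda>T. measure_pmf.expectation (pep_chain J (static_rate J) (obs_time r T))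
      (\<lambda>\<eta>. \<Prod>i<m. height J (obs_time r T) \<eta> (obs_site J r s T) - real i) / sqrt T ^ m)
      \<longlongrightarrow> sqrt (r * real J / (2 * pi)) ^ m) at_top"
proof -
  define \<mu> where "\<mu> T = measure_pmf.expectation (pep_chain J (static_rate J) (obs_time r T))
      (\<lambda>\<eta>. height J (obs_time r T) \<eta> (obs_site J r s T))" for T
  define G where "G T = measure_pmf.expectation (pep_chain J (static_rate J) (obs_time r T))
      (\<lambda>\<eta>. \<Prod>i<m. height J (obs_time r T) \<eta> (obs_site J r s T) - real i)" for T
  define L where "L = sqrt (r * real J / (2 * pi))"
  have L: "L > 0" using J r by (simp add: L_def)
  have \<mu>: "((\<lambda>T. \<mu> T / sqrt T) \<longlongrightarrow> L) at_top" unfolding \<mu>_def L_def by (rule static_mean_limit[OF J r])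
  have "filterlim (\<lambda>T. \<mu> T / sqrt T * sqrt T) at_top at_top"
    by (rule filterlim_tendsto_pos_mult_at_top[OF \<mu> L sqrt_at_top])
  moreover have "\<forall>\<^sub>F T in at_top. \<mu> T / sqrt T * sqrt T = \<mu> T"
    using eventually_gt_at_top[of 0] by eventually_elim simp
  ultimately have \<mu>_top: "filterlim \<mu> at_top at_top"
    by (simp only: filterlim_cong[OF refl refl])
  define C where "C = real m ^ m * exp (real m + 2) * 2"
  have "((\<lambda>T. G T / \<mu> T ^ m - 1) \<longlongrightarrow> 0) at_top"
  proof (rule Lim_null_comparison)
    show "((\<lambda>T. C / sqrt (\<mu> T)) \<longlongrightarrow> 0) at_top"
      by (intro tendsto_divide_0[OF tendsto_const] filterlim_at_top_imp_at_infinity filterlim_compose[OF sqrt_at_top \<mu>_top])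
    have "\<forall>\<^sub>F T in at_top. \<mu> T \<ge> 1" using \<mu>_top by (simp add: filterlim_at_top)
    then show "\<forall>\<^sub>F T in at_top. norm (G T / \<mu> T ^ m - 1) \<le> C / sqrt (\<mu> T)"
      using obs_site_at_top[OF J r, of s]
    proof eventually_elim
      case (elim T)
      then show ?case using static_falling_moment[of "obs_site J r s T" J "obs_time r T" m]
        by (simp only: G_def \<mu>_def C_def real_norm_def)
    qed
  qed
  then have "((\<lambda>T. G T / \<mu> T ^ m) \<longlongrightarrow> 1) at_top" by (simp add: LIM_zero_iff)
  then have "((\<lambda>T. G T / \<mu> T ^ m * (\<mu> T / sqrt T) ^ m) \<longlongrightarrow> 1 * L ^ m) at_top"
    by (intro tendsto_mult tendsto_power \<mu>)
  moreover have "\<forall>\<^sub>F T in at_top. G T / \<mu> T ^ m * (\<mu> T / sqrt T) ^ m = G T / sqrt T ^ m"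
    using filterlim_at_top_dense[THEN iffD1, OF \<mu>_top, rule_format, of 0]
    by eventually_elim (simp add: power_divide)
  ultimately have "((\<lambda>T. G T / sqrt T ^ m) \<longlongrightarrow> 1 * L ^ m) at_top"
    by (rule Lim_transform_eventually)
  then show ?thesis by (simp add: G_def L_def)
qed


section \<open>From factorial to ordinary moments\<close>

lemma falling_nat_nonneg:
  fixes \<epsilon> :: real
  assumes "\<epsilon> \<ge> 0"
  shows "(\<Prod>i<m. real n * \<epsilon> - real i * \<epsilon>) \<ge> 0"
proof (cases "n < m")
  case True
  \<comment> \<open>Some factors may be negative here, but the integer \<open>n < m\<close> is
    itself a root.\<close>
  then have "(\<Prod>i<m. real n * \<epsilon> - real i * \<epsilon>) = 0" by (intro prod_zero bexI[of _ n]) auto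
  then show ?thesis by (simp only: order.refl)
next
  case False
  then show ?thesis using assms by (intro prod_nonneg) (auto intro!: mult_right_mono)
qed

text \<open>The error is measured by \<open>P\<close> itself, whose mean is the one quantity known
  to converge; this spares a separate moment bound for \<open>X\<close>. Replacing the factors costs
  \<open>\<epsilon>\<close> times a power of \<open>1 + X\<close>, and that power is in turn bounded
  through \<open>1 + P\<close>.\<close>

lemma factorial_moment_comparison:
  fixes \<sigma> c \<gamma> :: real
  assumes c: "c \<ge> 0" and \<gamma>: "\<gamma> > 0"
  obtains C where "C \<ge> 0" "\<And>\<epsilon> n X Y P. \<lbrakk>0 < \<epsilon>; \<epsilon> \<le> 1; X = real n * \<epsilon>; Y \<ge> 0; \<bar>Y - X - \<sigma>\<bar> \<le> c * \<epsilon>;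
      P = (\<Prod>i<m. (X - real i * \<epsilon>) * (Y + (\<gamma> + real i) * \<epsilon>))\<rbrakk> \<Longrightarrow>
      0 \<le> P \<and> \<bar>P - X ^ m * (X + \<sigma>) ^ m\<bar> \<le> C * \<epsilon> * (1 + P)"
proof -
  \<comment> \<open>\<open>M\<close> dominates all shifts: each factor is at most
    \<open>M * (1 + X)\<close> in absolute value and is displaced by at most
    \<open>M * \<epsilon>\<close>.\<close>
  define M where "M = 1 + \<bar>\<sigma>\<bar> + c + \<gamma> + real m"
  \<comment> \<open>Above \<open>N\<close> the losses \<open>i * \<epsilon> \<le> m\<close> and
    \<open>\<bar>\<sigma>\<bar> + c\<close> leave at least a quarter of \<open>1 + X\<close> in each
    of the \<open>2 * m\<close> factors; hence \<open>16 ^ m\<close> in \<open>C1\<close>.\<close>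
  define N where "N = 2 * (\<bar>\<sigma>\<bar> + c) + 2 * real m + 1"
  define C1 where "C1 = (1 + N) ^ (2 * m) + 16 ^ m"
  define C where "C = 2 * real m * M ^ (2 * m) * C1"
  have M: "M \<ge> 1" using c \<gamma> by (simp add: M_def)
  have N: "N \<ge> 1" using c by (simp add: N_def)
  have C0: "C \<ge> 0" using M N by (simp add: C_def C1_def)
  have main: "0 \<le> P \<and> \<bar>P - X ^ m * (X + \<sigma>) ^ m\<bar> \<le> C * \<epsilon> * (1 + P)"
    if \<epsilon>: "0 < \<epsilon>" "\<epsilon> \<le> 1" and X: "X = real n * \<epsilon>" and Y: "Y \<ge> 0" and YX: "\<bar>Y - X - \<sigma>\<bar> \<le> c * \<epsilon>"
      and P: "P = (\<Prod>i<m. (X - real i * \<epsilon>) * (Y + (\<gamma> + real i) * \<epsilon>))" for \<epsilon> n X Y P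
  proof -
    have X0: "X \<ge> 0" using X \<epsilon> by simp
    have ce: "c * \<epsilon> \<le> c" using c \<epsilon> by (simp add: mult_left_le)
    have ge: "0 \<le> (\<gamma> + real i) * \<epsilon>" "(\<gamma> + real i) * \<epsilon> \<le> \<gamma> + real i" for i
      using \<gamma> \<epsilon> by (simp_all add: mult_left_le)
    have P0: "P \<ge> 0"
      unfolding P prod.distrib
    proof (rule mult_nonneg_nonneg)
      show "0 \<le> (\<Prod>i<m. X - real i * \<epsilon>)" unfolding X using \<epsilon> by (intro falling_nat_nonneg) simp
      show "0 \<le> (\<Prod>i<m. Y + (\<gamma> + real i) * \<epsilon>)" using Y ge by (intro prod_nonneg) auto
    qed
    define D where "D = M * (1 + X)"
    have D: "D \<ge> 1" using M X0 mult_mono[of 1 M 1 "1 + X"] by (simp add: D_def)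
    have MX: "M * X \<ge> X" using M X0 mult_right_mono[of 1 M X] by simp
    \<comment> \<open>Division by \<open>D^2\<close> brings each pair of factors into [-1, 1], where
      two products differ by at most the sum of the differences of their factors.\<close>
    have bound: "\<bar>P - X ^ m * (X + \<sigma>) ^ m\<bar> \<le> D ^ (2 * m) * (2 * real m * \<epsilon>)"
    proof -
      define z where "z i = (X - real i * \<epsilon>) * (Y + (\<gamma> + real i) * \<epsilon>) / D\<^sup>2" for i
      define w where "w = X * (X + \<sigma>) / D\<^sup>2"
      have f: "\<bar>X - real i * \<epsilon>\<bar> \<le> D" "\<bar>Y + (\<gamma> + real i) * \<epsilon>\<bar> \<le> D" "\<bar>X\<bar> \<le> D" "\<bar>X + \<sigma>\<bar> \<le> D"
        "\<bar>(X - real i * \<epsilon>) - X\<bar> \<le> M * \<epsilon>" "\<bar>(Y + (\<gamma> + real i) * \<epsilon>) - (X + \<sigma>)\<bar> \<le> M * \<epsilon>" if "i < m" for i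
      proof -
        have im: "real i \<le> real m" using that by simp
        have ie: "0 \<le> real i * \<epsilon>" "real i * \<epsilon> \<le> real m" using \<epsilon> im mult_mono[of "real i" "real m" \<epsilon> 1] by auto
        have DM: "D = M * X + M" by (simp add: D_def algebra_simps)
        show "\<bar>X - real i * \<epsilon>\<bar> \<le> D" "\<bar>X\<bar> \<le> D" "\<bar>X + \<sigma>\<bar> \<le> D"
          unfolding DM using MX ie X0 c \<gamma> by (simp_all add: M_def)
        show "\<bar>Y + (\<gamma> + real i) * \<epsilon>\<bar> \<le> D"
        proof -
          have "\<bar>\<sigma>\<bar> + c + \<gamma> + real m \<le> M" by (simp add: M_def)
          then show ?thesis unfolding DM using MX ge[of i] im Y YX ce by linarith
        qed
        have "real i * \<epsilon> \<le> M * \<epsilon>" using im \<epsilon> c \<gamma> by (intro mult_right_mono) (auto simp: M_def)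
        then show "\<bar>(X - real i * \<epsilon>) - X\<bar> \<le> M * \<epsilon>" using ie by simp
        have "c * \<epsilon> + (\<gamma> + real i) * \<epsilon> = (c + \<gamma> + real i) * \<epsilon>" by (simp add: algebra_simps)
        also have "\<dots> \<le> M * \<epsilon>" using im \<epsilon> c \<gamma> by (intro mult_right_mono) (auto simp: M_def)
        finally show "\<bar>(Y + (\<gamma> + real i) * \<epsilon>) - (X + \<sigma>)\<bar> \<le> M * \<epsilon>" using YX ge[of i] by linarith
      qed
      have D2: "D\<^sup>2 = D * D" by (simp add: power2_eq_square)
      have small: "\<bar>u * v / D\<^sup>2\<bar> \<le> 1" if "\<bar>u\<bar> \<le> D" "\<bar>v\<bar> \<le> D" for u v
        using that D mult_mono[of "\<bar>u\<bar>" D "\<bar>v\<bar>" D] unfolding D2 by (simp add: abs_mult)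
      have zw: "\<bar>z i - w\<bar> \<le> 2 * \<epsilon>" if "i < m" for i
      proof -
        let ?u = "X - real i * \<epsilon>" and ?v = "Y + (\<gamma> + real i) * \<epsilon>"
        have "?u * ?v - X * (X + \<sigma>) = ?u * (?v - (X + \<sigma>)) + (?u - X) * (X + \<sigma>)" by (simp add: algebra_simps)
        also have "\<bar>\<dots>\<bar> \<le> \<bar>?u\<bar> * \<bar>?v - (X + \<sigma>)\<bar> + \<bar>?u - X\<bar> * \<bar>X + \<sigma>\<bar>"
          unfolding abs_mult[symmetric] by (rule abs_triangle_ineq)
        also have "\<dots> \<le> D * (M * \<epsilon>) + (M * \<epsilon>) * D"
          using D M \<epsilon> f[OF that] by (intro add_mono mult_mono) auto
        also have "\<dots> \<le> 2 * \<epsilon> * D\<^sup>2"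
        proof -
          have "M \<le> D" using M X0 by (simp add: D_def algebra_simps)
          then have "D * \<epsilon> * M \<le> D * \<epsilon> * D" using D \<epsilon> by (intro mult_left_mono) auto
          then show ?thesis by (simp add: D2 algebra_simps)
        qed
        finally have "\<bar>?u * ?v - X * (X + \<sigma>)\<bar> / D\<^sup>2 \<le> 2 * \<epsilon>" using D by (simp add: divide_le_eq)
        moreover have "z i - w = (?u * ?v - X * (X + \<sigma>)) / D\<^sup>2" by (simp add: z_def w_def diff_divide_distrib)
        ultimately show ?thesis by (simp only: abs_divide) simp
      qed
      have "norm ((\<Prod>i<m. z i) - (\<Prod>i<m. w)) \<le> (\<Sum>i<m. norm (z i - w))"
      proof (rule norm_prod_diff)
        fix i assume "i \<in> {..<m}"
        then have "i < m" by simp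
        show "norm (z i) \<le> 1" unfolding z_def real_norm_def by (rule small[OF f(1,2)[OF \<open>i < m\<close>]])
        show "norm w \<le> 1" unfolding w_def real_norm_def by (rule small[OF f(3,4)[OF \<open>i < m\<close>]])
      qed
      also have "\<dots> \<le> (\<Sum>i<m. 2 * \<epsilon>)" by (intro sum_mono) (use zw in auto)
      finally have "\<bar>(\<Prod>i<m. z i) - w ^ m\<bar> \<le> 2 * real m * \<epsilon>" by simp
      moreover have "(\<Prod>i<m. z i) = P / D ^ (2 * m)" "w ^ m = X ^ m * (X + \<sigma>) ^ m / D ^ (2 * m)"
        unfolding z_def w_def P by (simp_all add: prod_dividef power_divide power_mult power_mult_distrib)
      ultimately have "\<bar>P - X ^ m * (X + \<sigma>) ^ m\<bar> / D ^ (2 * m) \<le> 2 * real m * \<epsilon>"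
        using D by (simp add: diff_divide_distrib[symmetric] abs_divide)
      then show ?thesis using D by (simp add: divide_le_eq mult.commute)
    qed
    have growth: "(1 + X) ^ (2 * m) \<le> C1 * (1 + P)"
    proof (cases "X \<le> N")
      case True
      then have "(1 + X) ^ (2 * m) \<le> (1 + N) ^ (2 * m) * 1" using X0 by (simp add: power_mono)
      also have "\<dots> \<le> C1 * (1 + P)" using N P0 by (intro mult_mono) (auto simp: C1_def)
      finally show ?thesis .
    next
      case False
      have "((1 + X) / 4) * ((1 + X) / 4) \<le> (X - real i * \<epsilon>) * (Y + (\<gamma> + real i) * \<epsilon>)" if "i < m" for i
      proof (rule mult_mono)
        have "real i * \<epsilon> \<le> real m" using that \<epsilon> mult_mono[of "real i" "real m" \<epsilon> 1] by auto
        then show "(1 + X) / 4 \<le> X - real i * \<epsilon>" using False c by (simp add: N_def)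
        then show "0 \<le> X - real i * \<epsilon>" by (rule order_trans[rotated]) (use X0 in simp)
        show "(1 + X) / 4 \<le> Y + (\<gamma> + real i) * \<epsilon>" using False YX ce ge(1)[of i] c of_nat_0_le_iff[of m, where 'a = real] unfolding N_def by argo
      qed (use X0 in simp)
      then have "(\<Prod>i<m. ((1 + X) / 4) * ((1 + X) / 4)) \<le> P"
        unfolding P using X0 by (intro prod_mono) auto
      then have "(1 + X) ^ (2 * m) / 16 ^ m \<le> P"
        by (simp add: power_mult power_divide power_mult_distrib[symmetric] power2_eq_square)
      then have "(1 + X) ^ (2 * m) \<le> 16 ^ m * P" by (simp add: divide_le_eq mult.commute)
      also have "\<dots> \<le> C1 * (1 + P)" using N P0 by (intro mult_mono) (auto simp: C1_def)
      finally show ?thesis .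
    qed
    have "\<bar>P - X ^ m * (X + \<sigma>) ^ m\<bar> \<le> M ^ (2 * m) * (1 + X) ^ (2 * m) * (2 * real m * \<epsilon>)"
      using bound by (simp only: D_def power_mult_distrib)
    also have "\<dots> \<le> M ^ (2 * m) * (C1 * (1 + P)) * (2 * real m * \<epsilon>)"
      using growth M \<epsilon> by (intro mult_right_mono mult_left_mono) auto
    also have "\<dots> = C * \<epsilon> * (1 + P)" by (simp add: C_def mult_ac)
    finally show ?thesis using P0 by simp
  qed
  show ?thesis
  proof (rule that[of C])
    show "C \<ge> 0" by (rule C0)
    fix \<epsilon> n X Y P
    assume a: "0 < \<epsilon>" "\<epsilon> \<le> 1" "X = real n * \<epsilon>" "Y \<ge> 0" "\<bar>Y - X - \<sigma>\<bar> \<le> c * \<epsilon>"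
      "P = (\<Prod>i<m. (X - real i * \<epsilon>) * (Y + (\<gamma> + real i) * \<epsilon>))"
    show "0 \<le> P \<and> \<bar>P - X ^ m * (X + \<sigma>) ^ m\<bar> \<le> C * \<epsilon> * (1 + P)" by (rule main[OF a])
  qed
qed

section \<open>Moments of the Gamma law\<close>

lemma gamma_distribution_moment:
  fixes b \<gamma> :: real
  assumes b: "b > 0" and \<gamma>: "\<gamma> > 0"
  shows "((\<lambda>x. x ^ m * (b powr \<gamma> * x powr (\<gamma> - 1) * exp (- b * x) / Gamma \<gamma>)) has_integral
    (pochhammer \<gamma> m / b ^ m)) {0<..}"
proof -
  define s where "s = \<gamma> + real m"
  define g where "g t = indicator {0..} t * (t powr (s - 1) / exp t)" for t :: real
  define f where "f x = x ^ m * (b powr \<gamma> * x powr (\<gamma> - 1) * exp (- b * x) / Gamma \<gamma>)" for x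
  \<comment> \<open>The integrand is Euler's integrand for \<open>\<gamma> + m\<close> at
    \<open>b * x\<close>; \<open>C\<close> collects the powers of \<open>b\<close> and the
    normalisation.\<close>
  define C where "C = b powr (1 - real m) / Gamma \<gamma>"
  have s: "s > 0" using \<gamma> by (simp add: s_def)
  have G: "Gamma \<gamma> > 0" "Gamma s > 0" using \<gamma> s by (auto intro: Gamma_real_pos)
  have C: "C \<ge> 0" using G by (simp add: C_def)
  have g: "g \<in> borel_measurable borel" "\<And>t. g t \<ge> 0" by (auto simp: g_def[abs_def])
  have eq: "(if x \<in> {0<..} then f x else 0) = C * g (0 + b * x)" for x
  proof (cases "x > 0")
    case True
    have "x ^ m * (b powr \<gamma> * x powr (\<gamma> - 1)) = x powr (s - 1) * b powr \<gamma>"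
      using True by (simp add: s_def powr_realpow[symmetric] powr_add[symmetric] algebra_simps)
    moreover have "b powr (1 - real m) * (b * x) powr (s - 1) = x powr (s - 1) * b powr \<gamma>"
      using True b by (simp add: s_def powr_mult powr_add[symmetric] mult.assoc[symmetric])
    ultimately have "x ^ m * (b powr \<gamma> * x powr (\<gamma> - 1)) = b powr (1 - real m) * (b * x) powr (s - 1)" by simp
    then show ?thesis using True b by (simp add: f_def g_def C_def exp_minus field_simps)
  next
    case False
    \<comment> \<open>At \<open>x = 0\<close> this uses that \<open>0 powr\<close> any exponent is
      0, so the closed half-line in \<open>g\<close> does no harm.\<close>
    then have "g (b * x) = 0" using b s by (cases "x = 0") (auto simp: g_def indicator_def zero_le_mult_iff)
    then show ?thesis using False by simp
  qed
  have "ennreal (Gamma s) = (\<integral>\<^sup>+t. ennreal (g t) \<partial>lborel)"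
    using Gamma_conv_nn_integral_real[OF s] by (simp add: g_def)
  also have "\<dots> = ennreal b * (\<integral>\<^sup>+x. ennreal (g (0 + b * x)) \<partial>lborel)"
    using nn_integral_real_affine[of "\<lambda>t. ennreal (g t)" b 0] g b by simp
  finally have "ennreal (1 / b) * ennreal (Gamma s) = ennreal (1 / b) * (ennreal b * (\<integral>\<^sup>+x. ennreal (g (0 + b * x)) \<partial>lborel))" by simp
  also have "\<dots> = (\<integral>\<^sup>+x. ennreal (g (0 + b * x)) \<partial>lborel)"
    using b unfolding mult.assoc[symmetric] by (simp add: ennreal_mult[symmetric])
  finally have I: "(\<integral>\<^sup>+x. ennreal (g (0 + b * x)) \<partial>lborel) = ennreal (Gamma s / b)"
    using b G by (simp add: ennreal_mult[symmetric])
  have "(\<integral>\<^sup>+x. ennreal (C * g (0 + b * x)) \<partial>lborel) = ennreal C * (\<integral>\<^sup>+x. ennreal (g (0 + b * x)) \<partial>lborel)"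
    using C g by (subst nn_integral_cmult[symmetric]) (auto simp: ennreal_mult intro!: measurable_compose[OF _ g(1)])
  also have "\<dots> = ennreal (C * (Gamma s / b))" unfolding I using C G b by (intro ennreal_mult[symmetric]) auto
  also have "C * (Gamma s / b) = pochhammer \<gamma> m / b ^ m"
  proof -
    have "\<gamma> \<notin> \<int>\<^sub>\<le>\<^sub>0" using \<gamma> by (auto elim!: nonpos_Ints_cases)
    then have "pochhammer \<gamma> m = Gamma s / Gamma \<gamma>" by (simp add: pochhammer_Gamma s_def)
    moreover have "b powr (1 - real m) / b = 1 / b ^ m" using b by (simp add: powr_diff powr_realpow)
    moreover have "C * (Gamma s / b) = Gamma s / Gamma \<gamma> * (b powr (1 - real m) / b)" by (simp add: C_def mult.commute)
    ultimately show ?thesis by simp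
  qed
  finally have "((\<lambda>x. C * g (0 + b * x)) has_integral (pochhammer \<gamma> m / b ^ m)) UNIV"
    using C g b \<gamma> by (intro nn_integral_has_integral) (auto intro!: borel_measurable_times measurable_compose[OF _ g(1)] divide_nonneg_nonneg pochhammer_nonneg)
  then have "(f has_integral (pochhammer \<gamma> m / b ^ m)) {0<..}"
    unfolding eq[symmetric] by (simp only: has_integral_restrict_UNIV)
  then show ?thesis unfolding f_def .
qed

theorem theorem7p5:
  fixes m J :: nat and s r \<gamma> :: real
  assumes "m \<ge> 1" and "J \<ge> 1" and "r > 0" and "\<gamma> > real J + 1"
  shows "((\<lambda>T. measure_pmf.expectation (PEP_dist J \<gamma> (nat \<lfloor>r * T\<rfloor>))
              (\<lambda>\<eta>. (PEP_H J T s r \<eta>) ^ m * (PEP_H J T s r \<eta> + s * real (J + 1)) ^ m))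
          \<longlongrightarrow> (r * real J / (2 * pi)) powr (real m / 2) * pochhammer \<gamma> m) at_top
       \<and> ((\<lambda>x. x ^ m * (sqrt (2 * pi / (r * real J)) powr \<gamma> * x powr (\<gamma> - 1)
                         * exp (- sqrt (2 * pi / (r * real J)) * x) / Gamma \<gamma>))
            has_integral ((r * real J / (2 * pi)) powr (real m / 2) * pochhammer \<gamma> m)) {0<..}"
proof
  interpret pep_dual J "PEP_p J \<gamma>" "dyn_factor \<gamma>" by (rule pep_dyn[OF assms(4)])
  define L where "L = sqrt (r * real J / (2 * pi))"
  have rJ: "r * real J / (2 * pi) > 0" using assms by simp
  have L: "(r * real J / (2 * pi)) powr (real m / 2) = L ^ m"
  proof -
    have "L ^ m = L powr real m" using rJ by (simp add: L_def powr_realpow)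
    also have "\<dots> = ((r * real J / (2 * pi)) powr (1 / 2)) powr real m" using rJ by (simp add: L_def powr_half_sqrt)
    finally show ?thesis by (simp add: powr_powr)
  qed
  have \<gamma>: "\<gamma> > 0" using assms(4) by linarith
  have "L > 0" using rJ by (simp add: L_def)
  moreover have "sqrt (2 * pi / (r * real J)) = 1 / L" unfolding L_def by (simp add: real_sqrt_divide)
  ultimately show "((\<lambda>x. x ^ m * (sqrt (2 * pi / (r * real J)) powr \<gamma> * x powr (\<gamma> - 1)
                         * exp (- sqrt (2 * pi / (r * real J)) * x) / Gamma \<gamma>))
            has_integral ((r * real J / (2 * pi)) powr (real m / 2) * pochhammer \<gamma> m)) {0<..}"
    using gamma_distribution_moment[of "sqrt (2 * pi / (r * real J))" \<gamma> m] assms \<gamma>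
    unfolding L by (simp add: power_divide mult.commute)
  let ?E = "\<lambda>T. measure_pmf.expectation (PEP_dist J \<gamma> (obs_time r T))"
  let ?h = "\<lambda>T \<eta>. height J (obs_time r T) \<eta> (obs_site J r s T)"
  let ?a = "\<lambda>T \<eta>. holes J (obs_time r T) \<eta> (obs_site J r s T)"
  \<comment> \<open>Height and holes carry one factor \<open>\<epsilon> T\<close> each, so a pair is
    scaled by \<open>1 / sqrt T\<close>, which is the scale of a single static height.\<close>
  define \<epsilon> where "\<epsilon> T = T powr (-1/4)" for T :: real
  define P where "P T \<eta> = (\<Prod>i<m. (?h T \<eta> * \<epsilon> T - real i * \<epsilon> T) * (?a T \<eta> * \<epsilon> T + (\<gamma> + real i) * \<epsilon> T))" for T \<eta>
  define Q where "Q T \<eta> = PEP_H J T s r \<eta> ^ m * (PEP_H J T s r \<eta> + s * real (J + 1)) ^ m" for T \<eta>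
  have P_scale: "P T \<eta> = (\<Prod>i<m. (?h T \<eta> - real i) * (?a T \<eta> + \<gamma> + real i)) / sqrt T ^ m" if "T > 0" for T \<eta>
  proof -
    have "\<epsilon> T * \<epsilon> T = 1 / sqrt T"
      using that by (simp add: \<epsilon>_def powr_add[symmetric] powr_minus powr_half_sqrt[symmetric] field_simps)
    then have "(?h T \<eta> * \<epsilon> T - real i * \<epsilon> T) * (?a T \<eta> * \<epsilon> T + (\<gamma> + real i) * \<epsilon> T) =
      (?h T \<eta> - real i) * (?a T \<eta> + \<gamma> + real i) / sqrt T" for i
    proof -
      have "(?h T \<eta> * \<epsilon> T - real i * \<epsilon> T) * (?a T \<eta> * \<epsilon> T + (\<gamma> + real i) * \<epsilon> T) =
        (?h T \<eta> - real i) * (?a T \<eta> + \<gamma> + real i) * (\<epsilon> T * \<epsilon> T)" by (simp add: algebra_simps)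
      then show ?thesis unfolding \<open>\<epsilon> T * \<epsilon> T = 1 / sqrt T\<close> by simp
    qed
    then show ?thesis unfolding P_def by (simp add: prod_dividef)
  qed
  have "((\<lambda>T. pochhammer \<gamma> m * (measure_pmf.expectation (pep_chain J (static_rate J) (obs_time r T))
      (\<lambda>\<eta>. \<Prod>i<m. ?h T \<eta> - real i) / sqrt T ^ m)) \<longlongrightarrow> pochhammer \<gamma> m * L ^ m) at_top"
    unfolding L_def by (intro tendsto_mult tendsto_const static_falling_limit assms)
  moreover have "\<forall>\<^sub>F T in at_top. pochhammer \<gamma> m * (measure_pmf.expectation (pep_chain J (static_rate J) (obs_time r T))
      (\<lambda>\<eta>. \<Prod>i<m. ?h T \<eta> - real i) / sqrt T ^ m) = ?E T (P T)"
    using eventually_gt_at_top[of 0]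
  proof eventually_elim
    case (elim T)
    have "?E T (P T) = ?E T (\<lambda>\<eta>. \<Prod>i<m. (?h T \<eta> - real i) * (?a T \<eta> + \<gamma> + real i)) / sqrt T ^ m"
      unfolding P_scale[OF elim] by (rule integral_divide_zero)
    then show ?case unfolding dyn_static_moments[OF assms(4)] by simp
  qed
  ultimately have P_lim: "((\<lambda>T. ?E T (P T)) \<longlongrightarrow> pochhammer \<gamma> m * L ^ m) at_top"
    by (rule Lim_transform_eventually)
  define c where "c = 3 * real (J + 1)"
  have c: "c \<ge> 0" by (simp add: c_def)
  obtain C where C: "C \<ge> 0" and comp: "\<And>\<epsilon> n X Y P. \<lbrakk>0 < \<epsilon>; \<epsilon> \<le> 1; X = real n * \<epsilon>; Y \<ge> 0; \<bar>Y - X - s * real (J + 1)\<bar> \<le> c * \<epsilon>;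
      P = (\<Prod>i<m. (X - real i * \<epsilon>) * (Y + (\<gamma> + real i) * \<epsilon>))\<rbrakk> \<Longrightarrow>
      0 \<le> P \<and> \<bar>P - X ^ m * (X + s * real (J + 1)) ^ m\<bar> \<le> C * \<epsilon> * (1 + P)"
    by (rule factorial_moment_comparison[OF c \<gamma>, where m = m and \<sigma> = "s * real (J + 1)"]) blast
  \<comment> \<open>The comparison bounds the difference by a vanishing factor times
    \<open>1 + ?E T (P T)\<close>, which converges.\<close>
  have "((\<lambda>T. ?E T (Q T) - ?E T (P T)) \<longlongrightarrow> 0) at_top"
  proof (rule Lim_null_comparison)
    have "(\<epsilon> \<longlongrightarrow> 0) at_top" unfolding \<epsilon>_def by real_asymp
    then have "((\<lambda>T. C * \<epsilon> T * (1 + ?E T (P T))) \<longlongrightarrow> C * 0 * (1 + pochhammer \<gamma> m * L ^ m)) at_top"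
      by (intro tendsto_intros P_lim)
    then show "((\<lambda>T. C * \<epsilon> T * (1 + ?E T (P T))) \<longlongrightarrow> 0) at_top" by simp
    show "\<forall>\<^sub>F T in at_top. norm (?E T (Q T) - ?E T (P T)) \<le> C * \<epsilon> T * (1 + ?E T (P T))"
      using eventually_ge_at_top[of 1] obs_site_at_top[OF assms(2,3), of s]
    proof eventually_elim
      case (elim T)
      have \<epsilon>: "0 < \<epsilon> T" "\<epsilon> T \<le> 1" "\<epsilon> T * T powr (1/4) = 1"
        using elim by (auto simp: \<epsilon>_def powr_minus powr_add[symmetric] ge_one_powr_ge_zero divide_simps)
      have pt: "\<bar>Q T \<eta> - P T \<eta>\<bar> \<le> C * \<epsilon> T * (1 + P T \<eta>)" if st: "pep_state J (obs_time r T) \<eta>" for \<eta>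
      proof -
        \<comment> \<open>The comparison needs the height as a natural number: the sign of
          \<open>P\<close> rests on it.\<close>
        define n where "n = PEP_h \<eta> (obs_site J r s T)"
        have h: "?h T \<eta> = real n" unfolding n_def by (rule PEP_h_eq_height[symmetric, OF st elim(2)])
        have H: "PEP_H J T s r \<eta> = real n * \<epsilon> T" by (simp add: PEP_H_def obs_site_def n_def \<epsilon>_def mult.commute)
        have "\<bar>?a T \<eta> - ?h T \<eta> - s * real (J + 1) * T powr (1/4)\<bar> \<le> c"
          using obs_offset[OF assms(3), of T J s] elim unfolding holes_def c_def by (simp add: algebra_simps)
        then have "\<epsilon> T * \<bar>?a T \<eta> - ?h T \<eta> - s * real (J + 1) * T powr (1/4)\<bar> \<le> \<epsilon> T * c"
          using \<epsilon> by (intro mult_left_mono) auto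
        moreover have "\<epsilon> T * \<bar>?a T \<eta> - ?h T \<eta> - s * real (J + 1) * T powr (1/4)\<bar> =
            \<bar>?a T \<eta> * \<epsilon> T - real n * \<epsilon> T - s * real (J + 1)\<bar>"
        proof -
          have "\<epsilon> T * (?a T \<eta> - ?h T \<eta> - s * real (J + 1) * T powr (1/4)) =
            ?a T \<eta> * \<epsilon> T - real n * \<epsilon> T - s * real (J + 1) * (\<epsilon> T * T powr (1/4))"
            unfolding h by (simp only: right_diff_distrib mult_ac)
          then have "\<epsilon> T * (?a T \<eta> - ?h T \<eta> - s * real (J + 1) * T powr (1/4)) =
            ?a T \<eta> * \<epsilon> T - real n * \<epsilon> T - s * real (J + 1)" unfolding \<epsilon>(3) by simp
          then show ?thesis using \<epsilon>(1) by (metis abs_mult abs_of_pos)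
        qed
        ultimately have "\<bar>?a T \<eta> * \<epsilon> T - real n * \<epsilon> T - s * real (J + 1)\<bar> \<le> c * \<epsilon> T" by (simp add: mult.commute)
        moreover have "?a T \<eta> * \<epsilon> T \<ge> 0" using holes_nonneg[OF st elim(2)] \<epsilon> by simp
        ultimately have "\<bar>P T \<eta> - (real n * \<epsilon> T) ^ m * (real n * \<epsilon> T + s * real (J + 1)) ^ m\<bar> \<le> C * \<epsilon> T * (1 + P T \<eta>)"
          using comp[OF \<epsilon>(1,2) refl, of "?a T \<eta> * \<epsilon> T" n "P T \<eta>"] unfolding P_def h by blast
        then show ?thesis unfolding Q_def H by (simp only: abs_minus_commute)
      qed
      have int: "integrable (PEP_dist J \<gamma> t) g" for t and g :: "(nat \<Rightarrow> nat) \<Rightarrow> real"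
        unfolding PEP_dist_eq_chain by simp
      have "?E T (Q T) - ?E T (P T) = ?E T (\<lambda>\<eta>. Q T \<eta> - P T \<eta>)"
        by (rule Bochner_Integration.integral_diff[symmetric]) (rule int)+
      also have "\<bar>\<dots>\<bar> \<le> ?E T (\<lambda>\<eta>. \<bar>Q T \<eta> - P T \<eta>\<bar>)" by (rule integral_abs_bound)
      also have "\<dots> \<le> ?E T (\<lambda>\<eta>. C * \<epsilon> T * (1 + P T \<eta>))"
        unfolding PEP_dist_eq_chain by (rule chain_mono) (rule pt)
      also have "\<dots> = C * \<epsilon> T * (1 + ?E T (P T))"
        by (simp add: Bochner_Integration.integral_add[OF _ int])
      finally show ?case by simp
    qed
  qed
  from tendsto_add[OF this P_lim] have "((\<lambda>T. ?E T (Q T)) \<longlongrightarrow> pochhammer \<gamma> m * L ^ m) at_top" by simp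
  then show "((\<lambda>T. measure_pmf.expectation (PEP_dist J \<gamma> (nat \<lfloor>r * T\<rfloor>))
              (\<lambda>\<eta>. (PEP_H J T s r \<eta>) ^ m * (PEP_H J T s r \<eta> + s * real (J + 1)) ^ m))
          \<longlongrightarrow> (r * real J / (2 * pi)) powr (real m / 2) * pochhammer \<gamma> m) at_top"
    unfolding L Q_def obs_time_def by (simp only: mult.commute)
qed

end
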